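(* Let $k \geq 1$ and $\alpha,\beta \in [0,1]$. Then $(\alpha,\beta) \in \mathsf{EXT^{p}}(k)$ if and only if one of the following holds: (i) $k = 1$ and $\beta \leq \alpha$; (ii) $k \geq 2$ and $\beta < \frac{k\alpha}{1+(k-1)\alpha}$; or (iii) $k \geq 2$, $\beta = \frac{k\alpha}{1+(k-1)\alpha}$, and $\alpha$ and $\beta$ are computable reals.
   Context: $C$ denotes plain Kolmogorov complexity: fix an optimal (universal) partial computable machine $\mathbb{U}:\{0,1\}^*\to\{0,1\}^*$ and set $C(\sigma)=\min\{|p| : \mathbb{U}(p)=\sigma\}$. For $k \geq 1$, $\mathsf{EXT^{p}}(k)$ is the set of pairs of reals $(\alpha,\beta)$ with $\alpha,\beta\in[0,1]$ for which there exist a total one-to-one computable function $f:\mathbb{N}\to\mathbb{N}$, $k$ partial computable functions $\Gamma_1,\ldots,\Gamma_k:\{0,1\}^*\to\{0,1\}^*$, and a constant $d\in\mathbb{N}$ such that for all $n$ and every string $\sigma$ with $|\sigma|=f(n)$: $|\Gamma_i(\sigma)|=n$ for every $i\le k$ for which $\Gamma_i(\sigma)$ is defined, and if furthermore $C(\sigma)\geq \alpha|\sigma|+d$, then for some $i$, $\Gamma_i(\sigma)$ is defined and $C(\Gamma_i(\sigma))\geq \beta|\Gamma_i(\sigma)|-d$. *)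

theory Defs
  imports Complex_Main "HOL-Library.Nat_Bijection"
begin

text \<open>
  Kleene's partial recursive functions in unary form: several arguments are passed as one
  number via the Cantor pairing \<^const>\<open>prod_encode\<close>. In \<open>prim_rec\<close> and \<open>minim\<close> all
  operations are strict; the minimisation requires every value below the result to be
  defined and nonzero.
\<close>

inductive partial_recursive :: "(nat \<rightharpoonup> nat) \<Rightarrow> bool" where
  zero: "partial_recursive (\<lambda>_. Some 0)"
| succ: "partial_recursive (\<lambda>n. Some (Suc n))"
| left: "partial_recursive (\<lambda>n. Some (fst (prod_decode n)))"
| right: "partial_recursive (\<lambda>n. Some (snd (prod_decode n)))"
| pair: "partial_recursive f \<Longrightarrow> partial_recursive g \<Longrightarrow>
    partial_recursive (\<lambda>n. Option.bind (f n) (\<lambda>a. Option.bind (g n) (\<lambda>b. Some (prod_encode (a, b)))))"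
| comp: "partial_recursive f \<Longrightarrow> partial_recursive g \<Longrightarrow>
    partial_recursive (\<lambda>n. Option.bind (g n) f)"
| prim_rec: "partial_recursive f \<Longrightarrow> partial_recursive g \<Longrightarrow>
    partial_recursive (\<lambda>n. case prod_decode n of (a, m) \<Rightarrow>
      rec_nat (f a) (\<lambda>j r. Option.bind r (\<lambda>v. g (prod_encode (a, prod_encode (j, v))))) m)"
| minim: "partial_recursive f \<Longrightarrow>
    partial_recursive (\<lambda>a.
      if \<exists>m. f (prod_encode (a, m)) = Some 0 \<and> (\<forall>j<m. \<exists>v. f (prod_encode (a, j)) = Some (Suc v))
      then Some (LEAST m. f (prod_encode (a, m)) = Some 0)
      else None)"

definition total_computable :: "(nat \<Rightarrow> nat) \<Rightarrow> bool" where
  "total_computable f \<longleftrightarrow> partial_recursive (\<lambda>n. Some (f n))"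

text \<open>Binary strings are identified with natural numbers by bijective base-2 numeration,
  least significant digit first.\<close>

fun str_encode :: "bool list \<Rightarrow> nat" where
  "str_encode [] = 0"
| "str_encode (b # bs) = 2 * str_encode bs + (if b then 2 else 1)"

lemma bij_str_encode: "bij str_encode"
proof (rule bijI)
  have "str_encode xs = str_encode ys \<Longrightarrow> xs = ys" for xs ys
  proof (induction xs arbitrary: ys)
    case Nil
    then show ?case by (cases ys) (auto split: if_splits)
  next
    case (Cons a xs)
    from Cons.prems obtain b zs where ys: "ys = b # zs"
      by (cases ys) (auto split: if_splits)
    with Cons.prems have eq: "2 * str_encode xs + (if a then 2 else 1) = 2 * str_encode zs + (if b then 2 else 1)"
      by simp
    hence "a = b" by (cases a; cases b; simp; presburger)
    with eq have "str_encode xs = str_encode zs" by simp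
    with Cons.IH \<open>a = b\<close> ys show ?case by simp
  qed
  thus "inj str_encode" by (rule injI)
  have "\<exists>xs. n = str_encode xs" for n
  proof (induction n rule: less_induct)
    case (less n)
    show ?case
    proof (cases "n = 0")
      case True
      then have "n = str_encode []" by simp
      then show ?thesis ..
    next
      case False
      then have "(n - 1) div 2 < n" by auto
      from less.IH[OF this] obtain xs where xs: "(n - 1) div 2 = str_encode xs" by blast
      have "n = 2 * ((n - 1) div 2) + (if even n then 2 else 1)" using False by presburger
      then have "n = str_encode (even n # xs)" using xs by simp
      then show ?thesis ..
    qed
  qed
  thus "surj str_encode" by (auto simp: surj_def)
qed

definition partial_computable :: "(bool list \<rightharpoonup> bool list) \<Rightarrow> bool" where
  "partial_computable \<Gamma> \<longleftrightarrow>
     (\<exists>g. partial_recursive g \<and> (\<forall>\<sigma>. g (str_encode \<sigma>) = map_option str_encode (\<Gamma> \<sigma>)))"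

definition computable_real :: "real \<Rightarrow> bool" where
  "computable_real x \<longleftrightarrow>
     (\<exists>p q. total_computable p \<and> total_computable q \<and>
        (\<forall>n. \<bar>x - of_int (int_decode (p n)) / real (Suc (q n))\<bar> \<le> 1 / 2 ^ n))"

definition optimal_machine :: "(bool list \<rightharpoonup> bool list) \<Rightarrow> bool" where
  "optimal_machine U \<longleftrightarrow> partial_computable U \<and>
     (\<forall>M. partial_computable M \<longrightarrow>
        (\<exists>c. \<forall>p \<sigma>. M p = Some \<sigma> \<longrightarrow> (\<exists>q. U q = Some \<sigma> \<and> length q \<le> length p + c)))"

text \<open>For an optimal machine every string has a description, so the minimum exists.\<close>

definition plain_complexity :: "(bool list \<rightharpoonup> bool list) \<Rightarrow> bool list \<Rightarrow> nat" where
  "plain_complexity U \<sigma> = (LEAST l. \<exists>p. U p = Some \<sigma> \<and> length p = l)"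

definition EXTp :: "(bool list \<rightharpoonup> bool list) \<Rightarrow> nat \<Rightarrow> (real \<times> real) set" where
  "EXTp U k = {(\<alpha>, \<beta>). \<alpha> \<in> {0..1} \<and> \<beta> \<in> {0..1} \<and>
     (\<exists>(f :: nat \<Rightarrow> nat) (\<Gamma> :: nat \<Rightarrow> bool list \<rightharpoonup> bool list) (d :: nat).
        total_computable f \<and> inj f \<and> (\<forall>i\<in>{1..k}. partial_computable (\<Gamma> i)) \<and>
        (\<forall>n \<sigma>. length \<sigma> = f n \<longrightarrow>
           (\<forall>i\<in>{1..k}. \<forall>\<tau>. \<Gamma> i \<sigma> = Some \<tau> \<longrightarrow> length \<tau> = n) \<and>
           (real (plain_complexity U \<sigma>) \<ge> \<alpha> * real (length \<sigma>) + real d \<longrightarrow>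
              (\<exists>i\<in>{1..k}. \<exists>\<tau>. \<Gamma> i \<sigma> = Some \<tau> \<and>
                 real (plain_complexity U \<tau>) \<ge> \<beta> * real (length \<tau>) - real d))))}"

end

theory Submission
  imports Defs
begin

text \<open>
  Write \<open>N = f n\<close> and \<open>g \<alpha> = k \<alpha> / (1 + (k - 1) \<alpha>)\<close>.

  Necessity. Inputs \<open>\<rho>0\<dots>0\<close> with \<open>\<rho>\<close> a random string of length about \<open>\<alpha> N\<close> show
  \<open>\<beta> n \<le> \<alpha> N + O(log n)\<close>. Conversely, split the strings of length \<open>n\<close> into \<open>2\<^sup>n\<^sup>-\<^sup>b\<close> blocks according to
  their bits beyond the first \<open>b\<close>. Repeated pigeonholing over the functions that converge on many inputs yields a
  computable choice of at most \<open>k\<close> blocks such that about \<open>2 ^ (N - k (n - b))\<close> inputs have all their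
  defined outputs in these blocks. With \<open>b\<close> slightly less than \<open>\<beta> n\<close> all these outputs are simple, so
  the inputs must be simple too, and counting gives \<open>(1 - \<alpha>) N \<le> k (1 - \<beta>) n + O(log n)\<close>. Together
  the bounds give \<open>\<beta> \<le> g \<alpha>\<close>. In the case of equality they force \<open>f n / n\<close> to converge to
  \<open>\<beta> / \<alpha> = k - (k - 1) \<beta>\<close> at a computable rate, so that \<open>\<alpha>\<close> and \<open>\<beta>\<close> are computable if \<open>k \<ge> 2\<close>.

  Sufficiency. Below the curve one passes to a rational point on it. For computable \<open>\<beta> = g \<alpha>\<close> let
  \<open>b n\<close> approximate \<open>\<beta> n\<close> and \<open>N = n + (k - 1) (n - b n)\<close>. The first function outputs the first \<open>n\<close>
  bits of the input. Whenever such an output turns out to have a program of length less than \<open>b n\<close>, it is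
  replaced by this program, padded to length \<open>b n\<close>, and the next function outputs the first \<open>n\<close> bits of the
  shortened string. If all \<open>k\<close> outputs are simple, then \<open>b n \<approx> \<alpha> N\<close> bits remain, and they describe the input.
\<close>

section \<open>Computable functions\<close>

definition pfst :: "nat \<Rightarrow> nat" where "pfst z = fst (prod_decode z)"
definition psnd :: "nat \<Rightarrow> nat" where "psnd z = snd (prod_decode z)"

lemma pfst_encode [simp]: "pfst (prod_encode (a, b)) = a"
  and psnd_encode [simp]: "psnd (prod_encode (a, b)) = b"
  by (simp_all add: pfst_def psnd_def)

definition decidable :: "(nat \<Rightarrow> bool) \<Rightarrow> bool" where
  "decidable P \<longleftrightarrow> total_computable (\<lambda>x. of_bool (P x))"

lemma tc_comp: "total_computable f \<Longrightarrow> total_computable g \<Longrightarrow> total_computable (\<lambda>x. f (g x))"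
  unfolding total_computable_def using partial_recursive.comp[of "\<lambda>n. Some (f n)" "\<lambda>n. Some (g n)"] by simp

lemma tc_pair: "total_computable f \<Longrightarrow> total_computable g \<Longrightarrow> total_computable (\<lambda>x. prod_encode (f x, g x))"
  unfolding total_computable_def using partial_recursive.pair[of "\<lambda>n. Some (f n)" "\<lambda>n. Some (g n)"] by simp

lemma tc_pfst: "total_computable f \<Longrightarrow> total_computable (\<lambda>x. pfst (f x))"
  by (rule tc_comp[where f = pfst]) (simp_all add: total_computable_def pfst_def partial_recursive.left)

lemma tc_psnd: "total_computable f \<Longrightarrow> total_computable (\<lambda>x. psnd (f x))"
  by (rule tc_comp[where f = psnd]) (simp_all add: total_computable_def psnd_def partial_recursive.right)

lemma tc_Suc: "total_computable f \<Longrightarrow> total_computable (\<lambda>x. Suc (f x))"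
  by (rule tc_comp[where f = Suc]) (simp_all add: total_computable_def partial_recursive.succ)

text \<open>The identity is not among the initial functions; it arises by pairing the two
  projections.\<close>

lemma tc_id: "total_computable (\<lambda>x. x)"
proof -
  have "total_computable (\<lambda>x. prod_encode (pfst x, psnd x))"
    by (intro tc_pair) (simp_all add: total_computable_def pfst_def psnd_def partial_recursive.left partial_recursive.right)
  then show ?thesis by (simp add: pfst_def psnd_def)
qed

lemma tc_const: "total_computable (\<lambda>x. c)"
proof (induction c)
  case 0
  show ?case by (simp add: total_computable_def partial_recursive.zero)
next
  case (Suc c)
  then show ?case by (rule tc_Suc)
qed

text \<open>The parameter \<open>x\<close> travels as the first component of the argument of
  \<open>prim_rec\<close>. For total base and step functions the strict recursion never leaves
  \<open>Some\<close>, so it reduces to \<open>rec_nat\<close>.\<close>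

lemma tc_rec_nat:
  assumes a: "total_computable a" and g: "total_computable (\<lambda>z. G (pfst z) (pfst (psnd z)) (psnd (psnd z)))"
    and m: "total_computable m"
  shows "total_computable (\<lambda>x. rec_nat (a x) (\<lambda>j r. G x j r) (m x))"
proof -
  let ?g = "\<lambda>z. G (pfst z) (pfst (psnd z)) (psnd (psnd z))"
  have *: "rec_nat (Some (a u)) (\<lambda>j r. Option.bind r (\<lambda>v. Some (?g (prod_encode (u, prod_encode (j, v)))))) l
      = Some (rec_nat (a u) (\<lambda>j r. G u j r) l)" for u l
    by (induction l) auto
  have "total_computable (\<lambda>z. rec_nat (a (pfst z)) (\<lambda>j r. G (pfst z) j r) (psnd z))"
    using partial_recursive.prim_rec[OF a[unfolded total_computable_def] g[unfolded total_computable_def]]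
    unfolding total_computable_def * by (simp add: case_prod_beta pfst_def psnd_def)
  from tc_comp[OF this tc_pair[OF tc_id m]] show ?thesis by simp
qed

lemmas tc_basic = tc_id tc_const tc_pair tc_pfst tc_psnd tc_Suc

lemma tc_add: assumes "total_computable f" "total_computable g"
  shows "total_computable (\<lambda>x. f x + g x)"
proof -
  have "rec_nat a (\<lambda>j r. Suc r) m = a + m" for a m :: nat by (induction m) auto
  then show ?thesis using tc_rec_nat[of f "\<lambda>x j r. Suc r" g] assms by (simp add: tc_basic)
qed

lemma tc_mult: assumes "total_computable f" "total_computable g"
  shows "total_computable (\<lambda>x. f x * g x)"
proof -
  have "rec_nat 0 (\<lambda>j r. r + a) m = a * m" for a m :: nat by (induction m) auto
  then show ?thesis using tc_rec_nat[of "\<lambda>x. 0" "\<lambda>x j r. r + f x" g] assms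
    by (simp add: tc_basic tc_add tc_comp[of f pfst])
qed

lemma tc_diff: assumes "total_computable f" "total_computable g"
  shows "total_computable (\<lambda>x. f x - g x)"
proof -
  \<comment> \<open>A recursion that returns its counter gives the predecessor; iterating the
    predecessor gives truncated subtraction.\<close>
  have "rec_nat 0 (\<lambda>j r. j) m = m - 1" for m :: nat by (induction m) auto
  then have p: "total_computable (\<lambda>x. x - 1)"
    using tc_rec_nat[of "\<lambda>x. 0" "\<lambda>x j r. j" "\<lambda>x. x"] by (simp add: tc_basic)
  have "rec_nat a (\<lambda>j r. r - 1) m = a - m" for a m :: nat by (induction m) auto
  then show ?thesis using tc_rec_nat[of f "\<lambda>x j r. r - 1" g] assms tc_comp[OF p, of "\<lambda>z. psnd (psnd z)"]
    by (simp add: tc_basic)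
qed

lemma tc_power: assumes "total_computable f" "total_computable g"
  shows "total_computable (\<lambda>x. f x ^ g x)"
proof -
  have "rec_nat 1 (\<lambda>j r. a * r) m = a ^ m" for a m :: nat by (induction m) auto
  then show ?thesis using tc_rec_nat[of "\<lambda>x. 1" "\<lambda>x j r. f x * r" g] assms
    by (simp add: tc_basic tc_mult tc_comp[of f pfst])
qed

lemma tc_sum:
  assumes "total_computable (\<lambda>z. F (pfst z) (psnd z))" "total_computable m"
  shows "total_computable (\<lambda>x. \<Sum>j<m x. F x j)"
proof -
  have *: "rec_nat 0 (\<lambda>j r. r + F x j) l = (\<Sum>j<l. F x j)" for x l by (induction l) auto
  have "total_computable (\<lambda>z. F (pfst z) (pfst (psnd z)))"
    using tc_comp[OF assms(1), of "\<lambda>z. prod_encode (pfst z, pfst (psnd z))"] by (simp add: tc_basic)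
  then have "total_computable (\<lambda>x. rec_nat 0 (\<lambda>j r. r + F x j) (m x))"
    by (intro tc_rec_nat tc_add tc_basic assms)
  then show ?thesis by (simp add: *)
qed

section \<open>Decidable predicates\<close>

lemma dc_not: "decidable P \<Longrightarrow> decidable (\<lambda>x. \<not> P x)"
proof -
  assume "decidable P"
  then have "total_computable (\<lambda>x. 1 - of_bool (P x))" unfolding decidable_def by (intro tc_diff tc_const)
  moreover have "1 - of_bool (P x) = (of_bool (\<not> P x) :: nat)" for x by simp
  ultimately show ?thesis by (simp only: decidable_def)
qed

lemma dc_conj: "decidable P \<Longrightarrow> decidable Q \<Longrightarrow> decidable (\<lambda>x. P x \<and> Q x)"
  using tc_mult[of "\<lambda>x. of_bool (P x)" "\<lambda>x. of_bool (Q x)"] by (simp add: decidable_def of_bool_conj)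

lemma dc_disj: "decidable P \<Longrightarrow> decidable Q \<Longrightarrow> decidable (\<lambda>x. P x \<or> Q x)"
  using dc_not[OF dc_conj[OF dc_not dc_not, of P Q]] by simp

lemma dc_le: assumes "total_computable f" "total_computable g" shows "decidable (\<lambda>x. f x \<le> g x)"
proof -
  have "total_computable (\<lambda>x. 1 - (f x - g x))" by (intro tc_diff tc_const assms)
  moreover have "1 - (f x - g x) = of_bool (f x \<le> g x)" for x by auto
  ultimately show ?thesis by (simp add: decidable_def)
qed

lemma dc_less: "total_computable f \<Longrightarrow> total_computable g \<Longrightarrow> decidable (\<lambda>x. f x < g x)"
  using dc_le[OF tc_Suc] by (simp add: Suc_le_eq)

lemma dc_eq: "total_computable f \<Longrightarrow> total_computable g \<Longrightarrow> decidable (\<lambda>x. f x = g x)"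
  using dc_conj[OF dc_le dc_le, of f g g f] by (simp add: eq_iff)

lemma dc_const: "decidable (\<lambda>x. c)"
  unfolding decidable_def by (rule tc_const)

lemma tc_if: assumes "decidable P" "total_computable f" "total_computable g"
  shows "total_computable (\<lambda>x. if P x then f x else g x)"
proof -
  have "total_computable (\<lambda>x. of_bool (P x) * f x + (1 - of_bool (P x)) * g x)"
    using assms unfolding decidable_def by (intro tc_add tc_mult tc_diff tc_const)
  moreover have "of_bool (P x) * f x + (1 - of_bool (P x)) * g x = (if P x then f x else g x)" for x by simp
  ultimately show ?thesis by simp
qed

lemma dc_ball: assumes "decidable (\<lambda>z. P (pfst z) (psnd z))" "total_computable m"
  shows "decidable (\<lambda>x. \<forall>j<m x. P x j)"
proof -
  have "decidable (\<lambda>x. (\<Sum>j<m x. of_bool (\<not> P x j)) = (0::nat))"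
    using dc_not[OF assms(1)] assms(2) unfolding decidable_def[of "\<lambda>z. \<not> P (pfst z) (psnd z)"]
    by (intro dc_eq tc_sum tc_const)
  moreover have "((\<Sum>j<l. of_bool (\<not> P x j)) = (0::nat)) = (\<forall>j<l. P x j)" for x l
    by auto
  ultimately show ?thesis by simp
qed

lemma dc_bex: assumes "decidable (\<lambda>z. P (pfst z) (psnd z))" "total_computable m"
  shows "decidable (\<lambda>x. \<exists>j<m x. P x j)"
  using dc_not[OF dc_ball[OF dc_not, of P m]] assms by simp

text \<open>Minimisation looks for the value 0, so it is applied to the characteristic function of
  the negation. As this function is total, the definedness clause of \<open>minim\<close> only says
  that no smaller number satisfies the predicate, and a least witness always has this
  property.\<close>

lemma pr_search:
  assumes "decidable (\<lambda>z. P (pfst z) (psnd z))"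
  shows "partial_recursive (\<lambda>x. if \<exists>w. P x w then Some (LEAST w. P x w) else None)"
proof -
  let ?f = "\<lambda>z. Some (of_bool (\<not> P (pfst z) (psnd z))) :: nat option"
  have "partial_recursive ?f"
    using dc_not[OF assms] by (simp add: decidable_def total_computable_def)
  note m = partial_recursive.minim[OF this]
  have "?f (prod_encode (a, j)) = Some 0 \<longleftrightarrow> P a j"
    "(\<exists>v. ?f (prod_encode (a, j)) = Some (Suc v)) \<longleftrightarrow> \<not> P a j" for a j by auto
  note * = m[unfolded this]
  have "(\<exists>m. P x m \<and> (\<forall>j<m. \<not> P x j)) = (\<exists>m. P x m)" for x
    using exists_least_iff[of "P x"] by blast
  with * show ?thesis by simp
qed

lemma tc_Least:
  assumes "decidable (\<lambda>z. P (pfst z) (psnd z))" "\<And>x. \<exists>w. P x w"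
  shows "total_computable (\<lambda>x. LEAST w. P x w)"
  using pr_search[OF assms(1)] assms(2) by (simp add: total_computable_def)

lemma tc_div: assumes "total_computable f" "total_computable g"
  shows "total_computable (\<lambda>x. f x div g x)"
proof -
  \<comment> \<open>The disjunct \<open>b = 0\<close> makes the search total and gives it the value
    0 on a zero divisor, in accordance with \<open>div\<close>.\<close>
  have e: "(LEAST q. b = 0 \<or> a < Suc q * b) = a div b" for a b :: nat
  proof (cases "b = 0")
    case False
    show ?thesis
    proof (rule Least_equality)
      show "b = 0 \<or> a < Suc (a div b) * b"
        using False dividend_less_div_times[of b a] by simp
      show "b = 0 \<or> a < Suc y * b \<Longrightarrow> a div b \<le> y" for y
        using False by (metis less_Suc_eq_le less_mult_imp_div_less)
    qed
  qed simp
  have ex: "\<exists>q. b = 0 \<or> a < Suc q * b" for a b :: nat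
    by (metis dividend_less_div_times mult_Suc neq0_conv)
  have "total_computable (\<lambda>x. LEAST q. g x = 0 \<or> f x < Suc q * g x)"
    by (intro tc_Least dc_disj dc_eq dc_less tc_mult tc_basic tc_comp[OF assms(1)] tc_comp[OF assms(2)] ex)
  then show ?thesis by (simp only: e)
qed

lemma tc_mod: "total_computable f \<Longrightarrow> total_computable g \<Longrightarrow> total_computable (\<lambda>x. f x mod g x)"
  using tc_diff[OF _ tc_mult[OF tc_div], of f f g g] by (simp add: minus_div_mult_eq_mod)

lemma tc_of_bool: "decidable P \<Longrightarrow> total_computable (\<lambda>x. of_bool (P x))"
  by (simp add: decidable_def)

lemmas tc_rules = tc_basic tc_of_bool tc_add tc_mult tc_diff tc_power tc_sum tc_if tc_div tc_mod
  dc_not dc_conj dc_disj dc_le dc_less dc_eq dc_const dc_ball dc_bex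

lemma pr_total_comp: "total_computable f \<Longrightarrow> partial_recursive g \<Longrightarrow> partial_recursive (\<lambda>x. g (f x))"
  unfolding total_computable_def using partial_recursive.comp[of g "\<lambda>n. Some (f n)"] by simp

text \<open>The input is paired with the result of the search, so that the output may depend on
  both.\<close>

lemma pr_search_out:
  assumes "decidable (\<lambda>z. P (pfst z) (psnd z))" "total_computable (\<lambda>z. F (pfst z) (psnd z))"
  shows "partial_recursive (\<lambda>x. if \<exists>w. P x w then Some (F x (LEAST w. P x w)) else None)"
proof -
  let ?s = "\<lambda>x. if \<exists>w. P x w then Some (LEAST w. P x w) else None"
  have "partial_recursive (\<lambda>n. Option.bind (Some n) (\<lambda>a. Option.bind (?s n) (\<lambda>b. Some (prod_encode (a, b)))))"
    using partial_recursive.pair[OF tc_id[unfolded total_computable_def] pr_search[OF assms(1)]] .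
  from partial_recursive.comp[OF assms(2)[unfolded total_computable_def] this]
  show ?thesis by (rule back_subst[where P = partial_recursive]) (auto split: if_splits)
qed

section \<open>Coded sequences and witnesses of convergence\<close>

fun seq_nth :: "nat \<Rightarrow> nat \<Rightarrow> nat" where
  "seq_nth w 0 = pfst w"
| "seq_nth w (Suc j) = seq_nth (psnd w) j"

text \<open>Every number codes an infinite sequence by repeated unpairing. No length is stored; it
  is enough that each finite prefix can be prescribed.\<close>

lemma seq_nth_surj: "\<exists>w. \<forall>j<m. seq_nth w j = v j"
proof (induction m arbitrary: v)
  case (Suc m)
  from Suc[of "\<lambda>j. v (Suc j)"] obtain w where w: "\<forall>j<m. seq_nth w j = v (Suc j)" by blast
  have "seq_nth (prod_encode (v 0, w)) j = v j" if "j < Suc m" for j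
    using that w by (cases j) auto
  then show ?case by blast
qed simp

lemma tc_seq_nth: assumes "total_computable f" "total_computable g"
  shows "total_computable (\<lambda>x. seq_nth (f x) (g x))"
proof -
  \<comment> \<open>The iteration applies \<open>psnd\<close> last where \<open>seq_nth\<close>
    applies it first; both orders agree because \<open>psnd\<close> commutes with its
    iterates.\<close>
  have *: "pfst (rec_nat w (\<lambda>j r. psnd r) m) = seq_nth w m" for w m
  proof -
    have "rec_nat (psnd w) (\<lambda>j r. psnd r) m = psnd (rec_nat w (\<lambda>j r. psnd r) m)" for w m
      by (induction m) auto
    then show ?thesis by (induction m arbitrary: w) (auto, metis)
  qed
  have "total_computable (\<lambda>x. pfst (rec_nat (f x) (\<lambda>j r. psnd r) (g x)))"
    by (intro tc_basic tc_rec_nat assms)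
  then show ?thesis by (simp add: *)
qed

text \<open>A witness for convergence plays the role of a computation; for primitive recursion and
  minimisation it is a coded sequence of witnesses.\<close>

lemma partial_recursive_witness:
  assumes "partial_recursive g"
  shows "\<exists>h. total_computable h \<and> (\<forall>x y. g x = Some y \<longleftrightarrow> (\<exists>w. h (prod_encode (x, w)) = Suc y))"
  using assms
proof induction
  case zero
  show ?case by (intro exI[of _ "\<lambda>z. Suc 0"]) (auto intro: tc_basic)
next
  case succ
  show ?case by (intro exI[of _ "\<lambda>z. Suc (Suc (pfst z))"]) (auto intro!: tc_basic)
next
  case left
  show ?case by (intro exI[of _ "\<lambda>z. Suc (pfst (pfst z))"]) (auto intro!: tc_basic simp flip: pfst_def)
next
  case right
  show ?case by (intro exI[of _ "\<lambda>z. Suc (psnd (pfst z))"]) (auto intro!: tc_basic simp flip: pfst_def psnd_def)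
next
  case (pair f g)
  then obtain hf hg where h: "total_computable hf" "\<And>x y. f x = Some y \<longleftrightarrow> (\<exists>w. hf (prod_encode (x, w)) = Suc y)"
    "total_computable hg" "\<And>x y. g x = Some y \<longleftrightarrow> (\<exists>w. hg (prod_encode (x, w)) = Suc y)" by blast
  \<comment> \<open>The value 0 signals that a witness fails. For a pair, as for a composition, the
    witness consists of one witness for each of the two functions.\<close>
  define A where "A z = hf (prod_encode (pfst z, pfst (psnd z)))" for z
  define B where "B z = hg (prod_encode (pfst z, psnd (psnd z)))" for z
  define H where "H z = (if A z = 0 \<or> B z = 0 then 0 else Suc (prod_encode (A z - 1, B z - 1)))" for z
  have "total_computable H" unfolding H_def A_def B_def
    by (intro tc_rules tc_comp[OF h(1)] tc_comp[OF h(3)])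
  moreover have "(Option.bind (f x) (\<lambda>a. Option.bind (g x) (\<lambda>b. Some (prod_encode (a, b)))) = Some y)
      \<longleftrightarrow> (\<exists>w. H (prod_encode (x, w)) = Suc y)" (is "?L = ?R") for x y
  proof
    assume ?L
    then obtain a b where "f x = Some a" "g x = Some b" and y: "y = prod_encode (a, b)"
      by (auto simp: bind_eq_Some_conv)
    then obtain u v where "hf (prod_encode (x, u)) = Suc a" "hg (prod_encode (x, v)) = Suc b"
      using h by blast
    then have "H (prod_encode (x, prod_encode (u, v))) = Suc y" by (simp add: H_def A_def B_def y)
    then show ?R by blast
  next
    assume ?R
    then obtain w where w: "H (prod_encode (x, w)) = Suc y" by blast
    then have "f x = Some (A (prod_encode (x, w)) - 1)" "g x = Some (B (prod_encode (x, w)) - 1)"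
      unfolding h H_def by (auto simp: A_def B_def split: if_splits)
    then show ?L using w by (auto simp: H_def split: if_splits)
  qed
  ultimately show ?case by blast
next
  case (comp f g)
  then obtain hf hg where h: "total_computable hf" "\<And>x y. f x = Some y \<longleftrightarrow> (\<exists>w. hf (prod_encode (x, w)) = Suc y)"
    "total_computable hg" "\<And>x y. g x = Some y \<longleftrightarrow> (\<exists>w. hg (prod_encode (x, w)) = Suc y)" by blast
  define B where "B z = hg (prod_encode (pfst z, pfst (psnd z)))" for z
  define H where "H z = (if B z = 0 then 0 else hf (prod_encode (B z - 1, psnd (psnd z))))" for z
  have "total_computable H" unfolding H_def B_def
    by (intro tc_rules tc_comp[OF h(1)] tc_comp[OF h(3)])
  moreover have "(Option.bind (g x) f = Some y) \<longleftrightarrow> (\<exists>w. H (prod_encode (x, w)) = Suc y)" (is "?L = ?R") for x y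
  proof
    assume ?L
    then obtain a where "g x = Some a" "f a = Some y" by (auto simp: bind_eq_Some_conv)
    then obtain u v where "hg (prod_encode (x, u)) = Suc a" "hf (prod_encode (a, v)) = Suc y"
      using h by blast
    then have "H (prod_encode (x, prod_encode (u, v))) = Suc y" by (simp add: H_def B_def)
    then show ?R by blast
  next
    assume ?R
    then obtain w where w: "H (prod_encode (x, w)) = Suc y" by blast
    then have "g x = Some (B (prod_encode (x, w)) - 1)" "f (B (prod_encode (x, w)) - 1) = Some y"
      unfolding h H_def by (auto simp: B_def split: if_splits)
    then show ?L by simp
  qed
  ultimately show ?case by blast
next
  case (prim_rec f g)
  then obtain hf hg where h: "total_computable hf" "\<And>x y. f x = Some y \<longleftrightarrow> (\<exists>w. hf (prod_encode (x, w)) = Suc y)"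
    "total_computable hg" "\<And>x y. g x = Some y \<longleftrightarrow> (\<exists>w. hg (prod_encode (x, w)) = Suc y)" by blast
  \<comment> \<open>Entry 0 of \<open>w\<close> witnesses the base value and entry
    \<open>Suc j\<close> the step from \<open>j\<close> to \<open>Suc j\<close>; a single failure
    makes all later values 0.\<close>
  define R where "R a m w = rec_nat (hf (prod_encode (a, seq_nth w 0)))
    (\<lambda>j r. if r = 0 then 0 else hg (prod_encode (prod_encode (a, prod_encode (j, r - 1)), seq_nth w (Suc j)))) m" for a m w
  define G where "G a m = rec_nat (f a) (\<lambda>j r. Option.bind r (\<lambda>v. g (prod_encode (a, prod_encode (j, v))))) m" for a m
  have tR: "total_computable (\<lambda>z. R (pfst (pfst z)) (psnd (pfst z)) (psnd z))" unfolding R_def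
    by (intro tc_rec_nat tc_rules tc_comp[OF h(1)] tc_comp[OF h(3)] tc_seq_nth)
  have "G a m = Some y \<longleftrightarrow> (\<exists>w. R a m w = Suc y)" for a m y
  proof
    assume "G a m = Some y"
    \<comment> \<open>The claim is strengthened for the induction: every code with a suitable prefix
      of \<open>m + 1\<close> entries works, so the next step may append an entry without disturbing
      the earlier ones.\<close>
    then have "\<exists>v. \<forall>w. (\<forall>j<Suc m. seq_nth w j = v j) \<longrightarrow> R a m w = Suc y"
    proof (induction m arbitrary: y)
      case 0
      then obtain u where "hf (prod_encode (a, u)) = Suc y" using h by (auto simp: G_def)
      then show ?case by (intro exI[of _ "\<lambda>_. u"]) (simp add: R_def del: seq_nth.simps)
    next
      case (Suc m)
      then obtain b where b: "G a m = Some b" "g (prod_encode (a, prod_encode (m, b))) = Some y"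
        by (auto simp: G_def bind_eq_Some_conv)
      from Suc.IH[OF b(1)] obtain v where v: "\<And>w. (\<forall>j<Suc m. seq_nth w j = v j) \<Longrightarrow> R a m w = Suc b" by blast
      from b(2) obtain u where u: "hg (prod_encode (prod_encode (a, prod_encode (m, b)), u)) = Suc y" using h by blast
      have "R a (Suc m) w = Suc y" if "\<forall>j<Suc (Suc m). seq_nth w j = (v(Suc m := u)) j" for w
      proof -
        have "R a m w = Suc b" using that by (intro v) auto
        moreover have "seq_nth w (Suc m) = u" using that by (simp del: seq_nth.simps)
        ultimately show ?thesis using u by (simp add: R_def del: seq_nth.simps)
      qed
      then show ?case by blast
    qed
    then show "\<exists>w. R a m w = Suc y" using seq_nth_surj by meson
  next
    assume "\<exists>w. R a m w = Suc y"
    then obtain w where "R a m w = Suc y" by blast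
    then show "G a m = Some y"
    proof (induction m arbitrary: y)
      case 0
      then show ?case using h by (auto simp: G_def R_def)
    next
      case (Suc m)
      then obtain b where b: "R a m w = Suc b" by (auto simp: R_def gr0_conv_Suc split: if_splits)
      with Suc.prems have "hg (prod_encode (prod_encode (a, prod_encode (m, b)), seq_nth w (Suc m))) = Suc y"
        by (simp add: R_def del: seq_nth.simps)
      then have "g (prod_encode (a, prod_encode (m, b))) = Some y" using h by blast
      with Suc.IH[OF b] show ?case by (simp add: G_def)
    qed
  qed
  then show ?case
    by (intro exI[of _ "\<lambda>z. R (pfst (pfst z)) (psnd (pfst z)) (psnd z)"])
      (simp add: tR case_prod_beta flip: G_def pfst_def psnd_def)
next
  case (minim f)
  then obtain h where h: "total_computable h" "\<And>x y. f x = Some y \<longleftrightarrow> (\<exists>w. h (prod_encode (x, w)) = Suc y)" by blast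
  \<comment> \<open>As \<open>h\<close> returns the successor of the value, 1 stands for a zero of
    \<open>f\<close> and anything larger for a nonzero value. Entry \<open>j\<close> of
    \<open>w\<close> witnesses the value at \<open>j\<close>.\<close>
  define Q where "Q a m w \<longleftrightarrow> h (prod_encode (prod_encode (a, m), seq_nth w m)) = 1 \<and>
    (\<forall>j<m. 1 < h (prod_encode (prod_encode (a, j), seq_nth w j)))" for a m w
  define H where "H z = (if Q (pfst z) (pfst (psnd z)) (psnd (psnd z)) then Suc (pfst (psnd z)) else 0)" for z
  have "total_computable H" unfolding H_def Q_def
    by (intro tc_rules tc_comp[OF h(1)] tc_seq_nth)
  moreover have "((if \<exists>m. f (prod_encode (a, m)) = Some 0 \<and> (\<forall>j<m. \<exists>v. f (prod_encode (a, j)) = Some (Suc v))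
      then Some (LEAST m. f (prod_encode (a, m)) = Some 0)
      else None) = Some y) \<longleftrightarrow> (\<exists>w. H (prod_encode (a, w)) = Suc y)" (is "?L = ?R") for a y
  proof -
    let ?P = "\<lambda>m. f (prod_encode (a, m)) = Some 0 \<and> (\<forall>j<m. \<exists>v. f (prod_encode (a, j)) = Some (Suc v))"
    have least: "(LEAST m. f (prod_encode (a, m)) = Some 0) = m" if "?P m" for m
    proof (rule Least_equality)
      fix y assume y: "f (prod_encode (a, y)) = Some 0"
      show "m \<le> y"
      proof (rule ccontr)
        assume "\<not> m \<le> y"
        with that obtain v where "f (prod_encode (a, y)) = Some (Suc v)" by (meson not_le)
        with y show False by simp
      qed
    qed (use that in simp)
    have "?L \<longleftrightarrow> ?P y"
    proof
      assume ?L
      then obtain m where m: "?P m" by (auto split: if_splits)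
      then have "m = y" using \<open>?L\<close> least[OF m] by (auto split: if_splits)
      with m show "?P y" by simp
    next
      assume "?P y"
      then show ?L using least by auto
    qed
    also have "\<dots> \<longleftrightarrow> (\<exists>w. Q a y w)"
    proof
      assume P: "?P y"
      have "\<exists>u. if j = y then h (prod_encode (prod_encode (a, j), u)) = 1 else j < y \<longrightarrow> 1 < h (prod_encode (prod_encode (a, j), u))" for j
      proof (cases "j < y")
        case True
        then obtain v where "f (prod_encode (a, j)) = Some (Suc v)" using P by blast
        then obtain u where "h (prod_encode (prod_encode (a, j), u)) = Suc (Suc v)" using h by blast
        then show ?thesis using True by (intro exI[of _ u]) auto
      next
        case False
        then show ?thesis using P h by auto
      qed
      then obtain u where u: "\<And>j. if j = y then h (prod_encode (prod_encode (a, j), u j)) = 1 else j < y \<longrightarrow> 1 < h (prod_encode (prod_encode (a, j), u j))"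
        by metis
      obtain w where "\<forall>j<Suc y. seq_nth w j = u j" using seq_nth_surj by blast
      moreover have "h (prod_encode (prod_encode (a, y), u y)) = 1" using u[of y] by simp
      moreover have "1 < h (prod_encode (prod_encode (a, j), u j))" if "j < y" for j using u[of j] that by simp
      ultimately have "Q a y w" by (simp add: Q_def)
      then show "\<exists>w. Q a y w" ..
    next
      assume "\<exists>w. Q a y w"
      then obtain w where w: "Q a y w" ..
      have "\<exists>v. f (prod_encode (a, j)) = Some (Suc v)" if "j < y" for j
      proof -
        have "1 < h (prod_encode (prod_encode (a, j), seq_nth w j))" using w that by (simp add: Q_def)
        then obtain v where "h (prod_encode (prod_encode (a, j), seq_nth w j)) = Suc (Suc v)"
          by (metis One_nat_def Suc_lessE gr0_conv_Suc less_nat_zero_code not_less_iff_gr_or_eq)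
        then show ?thesis using h by blast
      qed
      moreover have "f (prod_encode (a, y)) = Some 0" using w h by (auto simp: Q_def)
      ultimately show "?P y" by blast
    qed
    also have "\<dots> \<longleftrightarrow> ?R"
    proof
      assume "\<exists>w. Q a y w"
      then obtain w where "Q a y w" ..
      then have "H (prod_encode (a, prod_encode (y, w))) = Suc y" by (simp add: H_def)
      then show ?R ..
    qed (auto simp: H_def split: if_splits)
    finally show ?thesis .
  qed
  ultimately show ?case by blast
qed

section \<open>Strings as numbers and plain complexity\<close>

definition slen :: "nat \<Rightarrow> nat" where "slen x = (LEAST l. x + 1 < 2 ^ Suc l)"
text \<open>The digits of the numeration are 1 and 2. Subtracting \<open>2 ^ l - 1\<close>, the code
  of \<open>l\<close> zeros, turns the lowest \<open>l\<close> of them into ordinary binary digits,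
  and then division by \<open>2 ^ l\<close> separates the first \<open>l\<close> bits from the
  others.\<close>

definition sdrop :: "nat \<Rightarrow> nat \<Rightarrow> nat" where "sdrop l x = (x + 1 - 2 ^ l) div 2 ^ l"
definition stake :: "nat \<Rightarrow> nat \<Rightarrow> nat" where "stake l x = (x + 1 - 2 ^ l) mod 2 ^ l + (2 ^ l - 1)"
definition sapp :: "nat \<Rightarrow> nat \<Rightarrow> nat" where "sapp x y = x + 2 ^ slen x * y"

lemma str_encode_bounds:
  "2 ^ length s \<le> str_encode s + 1 \<and> str_encode s + 1 < 2 ^ Suc (length s)"
  by (induction s) auto

lemma str_encode_replicate_False: "str_encode (replicate a False) = 2 ^ a - 1"
proof (induction a)
  case (Suc a)
  obtain c :: nat where "2 ^ a = Suc c" using not0_implies_Suc[of "2 ^ a"] by auto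
  with Suc show ?case by simp
qed simp

lemma slen_encode [simp]: "slen (str_encode s) = length s"
  unfolding slen_def
proof (rule Least_equality)
  show "str_encode s + 1 < 2 ^ Suc (length s)" using str_encode_bounds by blast
  fix y assume "str_encode s + 1 < 2 ^ Suc y"
  with str_encode_bounds[of s] have "(2::nat) ^ length s < 2 ^ Suc y" by linarith
  then show "length s \<le> y" by (metis less_Suc_eq_le one_less_numeral_iff power_less_imp_less_exp semiring_norm(76))
qed

lemma str_encode_append: "str_encode (s @ t) = str_encode s + 2 ^ length s * str_encode t"
  by (induction s) (auto simp: algebra_simps)

lemma sapp_encode [simp]: "sapp (str_encode s) (str_encode t) = str_encode (s @ t)"
  by (simp add: sapp_def str_encode_append)

lemma sdrop_stake_encode_append:
  "sdrop (length s) (str_encode (s @ t)) = str_encode t"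
  "stake (length s) (str_encode (s @ t)) = str_encode s"
proof -
  define r where "r = str_encode s + 1 - 2 ^ length s"
  have r: "str_encode s + 1 = r + 2 ^ length s" "r < 2 ^ length s"
    using str_encode_bounds[of s] unfolding r_def by auto
  then have *: "str_encode (s @ t) + 1 - 2 ^ length s = r + 2 ^ length s * str_encode t"
    unfolding str_encode_append by linarith
  show "sdrop (length s) (str_encode (s @ t)) = str_encode t"
    unfolding sdrop_def * using r(2) by simp
  show "stake (length s) (str_encode (s @ t)) = str_encode s"
    unfolding stake_def * using r by simp
qed

lemma sdrop_encode [simp]: "l \<le> length s \<Longrightarrow> sdrop l (str_encode s) = str_encode (drop l s)"
  using sdrop_stake_encode_append(1)[of "take l s" "drop l s"] by simp

lemma stake_encode [simp]: "l \<le> length s \<Longrightarrow> stake l (str_encode s) = str_encode (take l s)"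
  using sdrop_stake_encode_append(2)[of "take l s" "drop l s"] by simp

lemma tc_slen: "total_computable f \<Longrightarrow> total_computable (\<lambda>x. slen (f x))"
proof (rule tc_comp[of slen])
  have "\<exists>l. (x::nat) + 1 < 2 ^ Suc l" for x
  proof
    have "x + 1 < 2 ^ (x + 1)" by (rule less_exp)
    then show "x + 1 < 2 ^ Suc x" by simp
  qed
  then show "total_computable slen" unfolding slen_def by (intro tc_Least tc_rules)
qed

lemma tc_sdrop: "total_computable f \<Longrightarrow> total_computable g \<Longrightarrow> total_computable (\<lambda>x. sdrop (f x) (g x))"
  unfolding sdrop_def by (intro tc_rules)

lemma tc_stake: "total_computable f \<Longrightarrow> total_computable g \<Longrightarrow> total_computable (\<lambda>x. stake (f x) (g x))"
  unfolding stake_def by (intro tc_rules)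

lemma tc_sapp: "total_computable f \<Longrightarrow> total_computable g \<Longrightarrow> total_computable (\<lambda>x. sapp (f x) (g x))"
  unfolding sapp_def by (intro tc_rules tc_slen)

lemmas tc_str = tc_rules tc_slen tc_sdrop tc_stake tc_sapp

lemma str_encode_surj: obtains s where "x = str_encode s"
  using bij_str_encode by (metis bij_pointE)

lemma str_encode_eq_iff [simp]: "str_encode s = str_encode t \<longleftrightarrow> s = t"
  using bij_str_encode by (metis bij_def injD)

text \<open>\<open>str_lead\<close> and \<open>str_body\<close> recover \<open>a\<close> and \<open>v\<close> from the string that consists of \<open>a\<close> zeros,
  a one, and \<open>v\<close>.\<close>

definition str_lead :: "nat \<Rightarrow> nat" where "str_lead x = (LEAST a. (x + 1) mod 2 ^ Suc a \<noteq> 0)"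
definition str_body :: "nat \<Rightarrow> nat" where "str_body x = ((x + 1) div 2 ^ str_lead x - 3) div 2"

text \<open>This identity justifies both decoders: the cofactor is odd, so \<open>a\<close> is the
  exponent of 2 in the incremented code, and the code of \<open>v\<close> is read off the
  cofactor.\<close>

lemma str_encode_marked: "str_encode (replicate a False @ True # v) + 1 = 2 ^ a * (2 * str_encode v + 3)"
proof -
  have "(1::nat) \<le> 2 ^ a" by simp
  then show ?thesis
    by (simp add: str_encode_append str_encode_replicate_False algebra_simps)
qed

lemma str_lead_marked [simp]: "str_lead (str_encode (replicate a False @ True # v)) = a"
  unfolding str_lead_def str_encode_marked
proof (rule Least_equality)
  have "\<not> (2::nat) ^ a * 2 dvd 2 ^ a * (2 * str_encode v + 3)" by (simp add: nat_mult_dvd_cancel_disj)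
  then show "2 ^ a * (2 * str_encode v + 3) mod 2 ^ Suc a \<noteq> 0"
    by (simp add: mult.commute dvd_eq_mod_eq_0)
next
  fix y assume *: "2 ^ a * (2 * str_encode v + 3) mod 2 ^ Suc y \<noteq> 0"
  show "a \<le> y"
  proof (rule ccontr)
    assume "\<not> a \<le> y"
    then have "(2::nat) ^ Suc y dvd 2 ^ a" by (intro le_imp_power_dvd) simp
    then have "(2::nat) ^ Suc y dvd 2 ^ a * (2 * str_encode v + 3)" by (rule dvd_mult2)
    with * show False by simp
  qed
qed

lemma str_body_marked [simp]: "str_body (str_encode (replicate a False @ True # v)) = str_encode v"
  unfolding str_body_def str_lead_marked str_encode_marked by simp

lemma tc_str_lead: "total_computable f \<Longrightarrow> total_computable (\<lambda>x. str_lead (f x))"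
proof (rule tc_comp[of str_lead])
  have "\<exists>a. (x + 1) mod 2 ^ Suc a \<noteq> 0" for x :: nat
  proof
    have "x + 1 < 2 ^ (x + 1)" by (rule less_exp)
    then show "(x + 1) mod 2 ^ Suc x \<noteq> 0" by simp
  qed
  then show "total_computable str_lead" unfolding str_lead_def by (intro tc_Least tc_rules)
qed

lemma tc_str_body: "total_computable f \<Longrightarrow> total_computable (\<lambda>x. str_body (f x))"
  unfolding str_body_def by (intro tc_rules tc_str_lead)

lemma partial_computable_of_recursive:
  assumes "partial_recursive g"
  shows "partial_computable (\<lambda>s. map_option (inv str_encode) (g (str_encode s)))"
proof -
  have "map_option str_encode (map_option (inv str_encode) y) = y" for y
    using bij_str_encode by (cases y) (auto simp: bij_is_surj surj_f_inv_f)
  then show ?thesis unfolding partial_computable_def using assms by metis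
qed

lemma inv_str_encode [simp]: "inv str_encode (str_encode s) = s"
  using bij_str_encode by (simp add: bij_is_inj)

lemma card_short_strings:
  "finite {p :: bool list. length p < m}" "card {p :: bool list. length p < m} < 2 ^ m"
proof -
  have "str_encode ` {p. length p < m} \<subseteq> {..<2 ^ m - 1}"
  proof safe
    fix p :: "bool list" assume "length p < m"
    then have "(2::nat) ^ Suc (length p) \<le> 2 ^ m" by (intro power_increasing) auto
    with str_encode_bounds[of p] show "str_encode p < 2 ^ m - 1" by linarith
  qed
  moreover have inj: "inj_on str_encode {p. length p < m}" by (simp add: inj_on_def)
  ultimately show "finite {p :: bool list. length p < m}" by (meson finite_imageD finite_lessThan finite_subset)
  have "card {p :: bool list. length p < m} \<le> 2 ^ m - 1"
    using card_inj_on_le[OF inj \<open>_ \<subseteq> _\<close>] by simp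
  moreover have "(0::nat) < 2 ^ m" by simp
  ultimately show "card {p :: bool list. length p < m} < 2 ^ m" by linarith
qed

lemma card_strings_length: "finite {s :: bool list. length s = m}" "card {s :: bool list. length s = m} = 2 ^ m"
  using finite_lists_length_eq[of "UNIV :: bool set" m] card_lists_length_eq[of "UNIV :: bool set" m] by simp_all

section \<open>Plain complexity of an optimal machine\<close>

locale optimal =
  fixes U :: "bool list \<rightharpoonup> bool list"
  assumes optimal: "optimal_machine U"
begin

abbreviation C :: "bool list \<Rightarrow> nat" where "C \<equiv> plain_complexity U"

lemma complexity_le: "U p = Some s \<Longrightarrow> C s \<le> length p"
  unfolding plain_complexity_def by (rule Least_le) blast

lemma complexity_le_machine:
  assumes "partial_computable M"
  shows "\<exists>c. \<forall>p s. M p = Some s \<longrightarrow> C s \<le> length p + c"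
  using optimal assms complexity_le unfolding optimal_machine_def by (meson le_trans)

lemma complexity_witness: "\<exists>p. U p = Some s \<and> length p = C s"
proof -
  \<comment> \<open>Since \<open>U\<close> simulates the identity machine, every string has a
    program and the minimum exists.\<close>
  have "partial_computable Some"
    unfolding partial_computable_def using tc_id by (auto simp: total_computable_def)
  then have "\<exists>l p. U p = Some s \<and> length p = l"
    using optimal unfolding optimal_machine_def by blast
  then show ?thesis unfolding plain_complexity_def by (rule LeastI_ex)
qed

text \<open>The advice \<open>a\<close> is put in front of the program in unary, as \<open>a\<close>
  zeros followed by a one. This is self-delimiting and costs \<open>a + 1\<close> bits.\<close>

lemma complexity_le_unary_advice:
  assumes "partial_recursive F"
  shows "\<exists>c. \<forall>a v t. F (prod_encode (a, str_encode v)) = Some (str_encode t) \<longrightarrow> C t \<le> length v + a + c"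
proof -
  define g where "g x = F (prod_encode (str_lead x, str_body x))" for x
  have "partial_recursive g" unfolding g_def
    by (rule pr_total_comp[OF _ assms]) (intro tc_str_lead tc_str_body tc_rules)
  from complexity_le_machine[OF partial_computable_of_recursive[OF this]] obtain c where
    c: "\<And>p s. map_option (inv str_encode) (g (str_encode p)) = Some s \<Longrightarrow> C s \<le> length p + c" by blast
  have "C t \<le> length v + a + (c + 1)" if "F (prod_encode (a, str_encode v)) = Some (str_encode t)" for a v t
    using c[of "replicate a False @ True # v" t] that by (simp add: g_def)
  then show ?thesis by blast
qed

text \<open>The string coded by \<open>n\<close> is put in front of the program, and its length is
  supplied as unary advice; this is the origin of the factor 2.\<close>

lemma complexity_le_conditional:
  assumes "partial_recursive F"
  shows "\<exists>c. \<forall>n v t. F (prod_encode (n, str_encode v)) = Some (str_encode t) \<longrightarrow> C t \<le> length v + 2 * slen n + c"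
proof -
  define G where "G z = F (prod_encode (stake (pfst z) (psnd z), sdrop (pfst z) (psnd z)))" for z
  have "partial_recursive G" unfolding G_def
    by (rule pr_total_comp[OF _ assms]) (intro tc_str)
  from complexity_le_unary_advice[OF this] obtain c where
    c: "\<And>a v t. G (prod_encode (a, str_encode v)) = Some (str_encode t) \<Longrightarrow> C t \<le> length v + a + c" by blast
  have "C t \<le> length v + 2 * slen n + c" if F: "F (prod_encode (n, str_encode v)) = Some (str_encode t)" for n v t
  proof -
    obtain e where e: "n = str_encode e" by (rule str_encode_surj)
    have "G (prod_encode (length e, str_encode (e @ v))) = Some (str_encode t)"
      using F by (simp add: G_def e sdrop_stake_encode_append)
    from c[OF this] show ?thesis by (simp add: e)
  qed
  then show ?thesis by blast
qed

text \<open>Distinct strings have distinct shortest programs, and fewer than \<open>2 ^ m\<close>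
  programs are shorter than \<open>m\<close>.\<close>

lemma card_low_complexity: "finite {s. C s < m}" "card {s. C s < m} < 2 ^ m"
proof -
  obtain p where p: "\<And>s. U (p s) = Some s" "\<And>s. length (p s) = C s" using complexity_witness by metis
  have inj: "inj_on p A" for A by (metis p(1) inj_onI option.inject)
  have sub: "p ` {s. C s < m} \<subseteq> {p. length p < m}" using p by auto
  show "finite {s. C s < m}" using finite_imageD[OF finite_subset[OF sub card_short_strings(1)] inj] .
  show "card {s. C s < m} < 2 ^ m"
    using card_inj_on_le[OF inj sub card_short_strings(1)] card_short_strings(2)[of m] by linarith
qed

lemma exists_complex:
  assumes "finite A" "2 ^ m \<le> card A"
  obtains s where "s \<in> A" "m \<le> C s"
proof -
  have "\<not> A \<subseteq> {s. C s < m}"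
    using card_mono[OF card_low_complexity(1), of A m] card_low_complexity(2)[of m] assms by auto
  then obtain s where "s \<in> A" "\<not> C s < m" by auto
  then show ?thesis using that[of s] by simp
qed

end

section \<open>Counting bounds for extractors\<close>

text \<open>In contrast to \<open>dc_ball\<close>, the index set is fixed and the decision
  procedures for different \<open>i\<close> may be unrelated. Below they belong to the different
  functions \<open>\<Gamma> i\<close>.\<close>

lemma dc_finite_ball: "finite P \<Longrightarrow> (\<And>i. i \<in> P \<Longrightarrow> decidable (Q i)) \<Longrightarrow> decidable (\<lambda>x. \<forall>i\<in>P. Q i x)"
  by (induction P rule: finite_induct) (auto intro: dc_const dc_conj)

text \<open>The codes of the strings of length \<open>N\<close> form the interval of
  \<open>2 ^ N\<close> numbers that starts at \<open>2 ^ N - 1\<close>. A count of strings thus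
  becomes a bounded sum, which is computable.\<close>

lemma sum_codes_of_length:
  "(\<Sum>j<2 ^ N. of_bool (Q (2 ^ N - 1 + j))) = card {s. length s = N \<and> Q (str_encode s)}"
proof -
  let ?g = "\<lambda>s. str_encode s + 1 - 2 ^ N"
  have b: "2 ^ N \<le> str_encode s + 1" "str_encode s + 1 < 2 * 2 ^ N" if "length s = N" for s :: "bool list"
    using str_encode_bounds[of s] that by auto
  have inj: "inj_on ?g {s. length s = N}"
  proof (rule inj_onI)
    fix s t :: "bool list" assume "s \<in> {s. length s = N}" "t \<in> {s. length s = N}" "?g s = ?g t"
    then have "str_encode s = str_encode t" using b[of s] b[of t] by (simp only: mem_Collect_eq) linarith
    then show "s = t" by simp
  qed
  have "?g ` {s. length s = N} \<subseteq> {..<2 ^ N}" using b by fastforce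
  then have "?g ` {s. length s = N} = {..<2 ^ N}"
    by (rule card_subset_eq[OF finite_lessThan]) (simp only: card_image[OF inj] card_strings_length card_lessThan)
  with inj have bij: "bij_betw ?g {s. length s = N} {..<2 ^ N}" by (simp add: bij_betw_def)
  have "(\<Sum>j<2 ^ N. of_bool (Q (2 ^ N - 1 + j))) = (\<Sum>s | length s = N. of_bool (Q (2 ^ N - 1 + ?g s)))"
    by (rule sum.reindex_bij_betw[OF bij, symmetric])
  also have "\<dots> = (\<Sum>s | length s = N. of_bool (Q (str_encode s)))"
  proof (rule sum.cong[OF refl])
    fix s :: "bool list" assume "s \<in> {s. length s = N}"
    then have "2 ^ N - 1 + ?g s = str_encode s" using b[of s] by simp
    then show "of_bool (Q (2 ^ N - 1 + ?g s)) = of_bool (Q (str_encode s))" by simp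
  qed
  also have "\<dots> = card {s. length s = N \<and> Q (str_encode s)}"
    unfolding of_bool_def by (subst sum.If_cases[OF card_strings_length(1)]) (simp add: Collect_conj_eq)
  finally show ?thesis .
qed

lemma pigeonhole_fibre:
  assumes "finite A" "finite B" "g ` A \<subseteq> B" "A \<noteq> {}"
  obtains y where "y \<in> B" "card A \<le> card {x \<in> A. g x = y} * card B"
proof -
  have B: "B \<noteq> {}" using assms by auto
  obtain y where y: "y \<in> B" "\<And>z. z \<in> B \<Longrightarrow> card {x \<in> A. g x = z} \<le> card {x \<in> A. g x = y}"
  proof -
    let ?I = "(\<lambda>y. card {x \<in> A. g x = y}) ` B"
    have "Max ?I \<in> ?I" using assms(2) B by (intro Max_in) auto
    then obtain y where "y \<in> B" "Max ?I = card {x \<in> A. g x = y}" by blast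
    then show ?thesis using that[of y] Max_ge[of ?I] assms(2) by auto
  qed
  have "card A = (\<Sum>z\<in>B. card {x \<in> A. g x = z})"
    using sum.group[OF assms(1,2,3), of "\<lambda>_. 1::nat"] by simp
  also have "\<dots> \<le> card B * card {x \<in> A. g x = y}"
    using sum_bounded_above[of B "\<lambda>z. card {x \<in> A. g x = z}"] y(2) by simp
  finally show ?thesis using that[OF y(1)] by (simp add: mult.commute)
qed

section \<open>The two rate bounds for an extractor\<close>

locale extractor = optimal +
  fixes k :: nat and f :: "nat \<Rightarrow> nat" and \<Gamma> :: "nat \<Rightarrow> bool list \<rightharpoonup> bool list" and d :: nat and \<alpha> \<beta> :: real
  assumes tc_f: "total_computable f" and inj_f: "inj f"
    and pc_\<Gamma>: "\<And>i. i \<in> {1..k} \<Longrightarrow> partial_computable (\<Gamma> i)"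
    and length_\<Gamma>: "\<And>n s i t. length s = f n \<Longrightarrow> i \<in> {1..k} \<Longrightarrow> \<Gamma> i s = Some t \<Longrightarrow> length t = n"
    and extracts: "\<And>n s. length s = f n \<Longrightarrow> \<alpha> * real (f n) + real d \<le> real (C s) \<Longrightarrow>
      \<exists>i\<in>{1..k}. \<exists>t. \<Gamma> i s = Some t \<and> \<beta> * real n - real d \<le> real (C t)"
    and \<alpha>: "\<alpha> \<in> {0..1}" and \<beta>: "\<beta> \<in> {0..1}" and k: "1 \<le> k"
begin

text \<open>The hypothesis says that a random string just long enough to be a complex input still
  fits into \<open>f n\<close> bits. After padding with zeros, every output is computable from
  \<open>n\<close> and the random part, so its complexity is bounded by the length of that
  part.\<close>

lemma output_rate_bound:
  "\<exists>c. \<forall>n. nat \<lceil>\<alpha> * f n\<rceil> + d \<le> f n \<longrightarrow> \<beta> * n \<le> \<alpha> * f n + 2 * slen n + real c"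
proof -
  have "\<exists>c. \<forall>n v t. length v \<le> f n \<longrightarrow> \<Gamma> i (v @ replicate (f n - length v) False) = Some t
      \<longrightarrow> C t \<le> length v + 2 * slen n + c" if i: "i \<in> {1..k}" for i
  proof -
    obtain g where g: "partial_recursive g" "\<And>s. g (str_encode s) = map_option str_encode (\<Gamma> i s)"
      using pc_\<Gamma>[OF i] unfolding partial_computable_def by blast
    \<comment> \<open>\<open>2 ^ a - 1\<close> is the code of \<open>a\<close> zeros, so
      \<open>F\<close> pads \<open>v\<close> to length \<open>f n\<close> before applying
      \<open>\<Gamma> i\<close>.\<close>
    define F where "F z = g (sapp (psnd z) (2 ^ (f (pfst z) - slen (psnd z)) - 1))" for z
    have "partial_recursive F" unfolding F_def
      by (rule pr_total_comp[OF _ g(1)]) (intro tc_str tc_comp[OF tc_f])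
    from complexity_le_conditional[OF this] obtain c where
      c: "\<And>n v t. F (prod_encode (n, str_encode v)) = Some (str_encode t) \<Longrightarrow> C t \<le> length v + 2 * slen n + c"
      by blast
    have "F (prod_encode (n, str_encode v)) = map_option str_encode (\<Gamma> i (v @ replicate (f n - length v) False))" for n v
    proof -
      have "sapp (str_encode v) (2 ^ (f n - length v) - 1) = str_encode (v @ replicate (f n - length v) False)"
        by (simp only: str_encode_replicate_False[symmetric] sapp_encode)
      then show ?thesis by (simp add: F_def g(2))
    qed
    with c have "\<And>n v t. \<Gamma> i (v @ replicate (f n - length v) False) = Some t \<Longrightarrow> C t \<le> length v + 2 * slen n + c"
      by auto
    then show ?thesis by blast
  qed
  then obtain c where c: "\<And>i n v t. \<lbrakk>i \<in> {1..k}; length v \<le> f n; \<Gamma> i (v @ replicate (f n - length v) False) = Some t\<rbrakk>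
      \<Longrightarrow> C t \<le> length v + 2 * slen n + c i" by metis
  \<comment> \<open>The sum dominates each of the finitely many constants.\<close>
  define c0 where "c0 = (\<Sum>i\<in>{1..k}. c i)"
  have "\<beta> * n \<le> \<alpha> * f n + 2 * slen n + real (c0 + 2 * d + 1)" if le: "nat \<lceil>\<alpha> * f n\<rceil> + d \<le> f n" for n
  proof -
    define m where "m = nat \<lceil>\<alpha> * f n\<rceil> + d"
    have "0 \<le> \<alpha> * f n" using \<alpha> by simp
    then have m: "\<alpha> * f n + d \<le> m" "m \<le> \<alpha> * f n + d + 1" unfolding m_def by linarith+
    define pad where "pad v = v @ replicate (f n - m) False" for v
    have "inj_on pad {v. length v = m}" by (simp add: pad_def inj_on_def)
    then have "2 ^ m \<le> card (pad ` {v. length v = m})" by (simp add: card_image card_strings_length)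
    then obtain s where s: "s \<in> pad ` {v. length v = m}" "m \<le> C s"
      using exists_complex[of "pad ` {v. length v = m}"] card_strings_length(1)[of m] by blast
    then obtain v where v: "length v = m" "s = pad v" by auto
    have "length s = f n" using v le by (simp add: pad_def m_def)
    moreover have "\<alpha> * f n + d \<le> C s" using m s(2) by linarith
    ultimately obtain i t where it: "i \<in> {1..k}" "\<Gamma> i s = Some t" "\<beta> * n - d \<le> C t"
      using extracts by blast
    have "C t \<le> m + 2 * slen n + c i" using c[of i v n t] it v le by (simp add: pad_def m_def)
    moreover have "c i \<le> c0" unfolding c0_def using it(1) by (intro member_le_sum) auto
    ultimately have "real (C t) \<le> m + 2 * slen n + c0" by linarith
    with it(3) m show ?thesis by simp
  qed
  then show ?thesis by blast
qed

text \<open>A cell consists of the inputs on which the functions in \<open>P\<close> converge and have the prescribed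
  values beyond the first \<open>b\<close> bits. Of the inputs in a heavy cell with \<open>P\<close> as large as possible, half
  meet no convergence outside \<open>P\<close>, and a heavy cell can be found by search.\<close>

definition cell :: "nat set \<Rightarrow> nat \<Rightarrow> nat \<Rightarrow> nat \<Rightarrow> bool list set" where
  "cell P n b u = {s. length s = f n \<and> (\<forall>i\<in>P. \<exists>t. \<Gamma> i s = Some t \<and> str_encode (drop b t) = seq_nth u i)}"

text \<open>Each member of \<open>P\<close> may cost a factor \<open>2 ^ (k + (n - b))\<close>: at
  most \<open>2 ^ (n - b)\<close> for the output beyond the first \<open>b\<close> bits, and
  \<open>2 * k \<le> 2 ^ k\<close> for the choice of the function and the loss of half of the
  inputs.\<close>

definition heavy :: "nat set \<Rightarrow> nat \<Rightarrow> nat \<Rightarrow> nat \<Rightarrow> bool" where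
  "heavy P n b u \<longleftrightarrow> 2 ^ f n \<le> card (cell P n b u) * 2 ^ (card P * (k + (n - b)))"

lemma finite_cell: "finite (cell P n b u)"
  by (rule finite_subset[OF _ card_strings_length(1)[of "f n"]]) (auto simp: cell_def)


text \<open>Heaviness is recognised in finite time, so a heavy cell can be computed from
  \<open>n\<close> and \<open>b\<close>. An output that agrees with this cell is then described by
  \<open>n\<close> and its first \<open>b\<close> bits. The fixed set \<open>P\<close> only
  influences the constant.\<close>

lemma heavy_cell_computable:
  assumes P: "P \<subseteq> {1..k}"
  shows "\<exists>c. \<forall>n b. b \<le> n \<longrightarrow> (\<exists>u. heavy P n b u) \<longrightarrow> (\<exists>u. heavy P n b u \<and>
    (\<forall>i\<in>P. \<forall>t. length t = n \<longrightarrow> str_encode (drop b t) = seq_nth u i \<longrightarrow> C t \<le> b + 2 * slen n + c))"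
proof -
  have fin: "finite P" using P by (rule finite_subset) simp
  have "\<forall>i\<in>P. \<exists>h. total_computable h \<and> (\<forall>s t. \<Gamma> i s = Some t \<longleftrightarrow> (\<exists>w. h (prod_encode (str_encode s, w)) = Suc (str_encode t)))"
  proof
    fix i assume "i \<in> P"
    obtain g where g: "partial_recursive g" "\<And>s. g (str_encode s) = map_option str_encode (\<Gamma> i s)"
      using pc_\<Gamma>[of i] \<open>i \<in> P\<close> P unfolding partial_computable_def by blast
    obtain h where h: "total_computable h" "\<And>x y. g x = Some y \<longleftrightarrow> (\<exists>w. h (prod_encode (x, w)) = Suc y)"
      using partial_recursive_witness[OF g(1)] by blast
    have "\<Gamma> i s = Some t \<longleftrightarrow> (\<exists>w. h (prod_encode (str_encode s, w)) = Suc (str_encode t))" for s t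
      unfolding h(2)[symmetric] g(2) by (cases "\<Gamma> i s") auto
    with h(1) show "\<exists>h. total_computable h \<and> (\<forall>s t. \<Gamma> i s = Some t \<longleftrightarrow> (\<exists>w. h (prod_encode (str_encode s, w)) = Suc (str_encode t)))"
      by blast
  qed
  from bchoice[OF this] obtain h where h: "\<And>i. i \<in> P \<Longrightarrow> total_computable (h i)"
    "\<And>i s t. i \<in> P \<Longrightarrow> \<Gamma> i s = Some t \<longleftrightarrow> (\<exists>w. h i (prod_encode (str_encode s, w)) = Suc (str_encode t))"
    by blast
  \<comment> \<open>In \<open>z\<close>, the first component bounds the stage of the simulation and
    the second one is the cell. \<open>S\<close> is the decidable approximation of
    \<open>heavy\<close> that counts only the inputs recognised by that stage.\<close>
  define conv where "conv b z x i \<longleftrightarrow> (\<exists>w<pfst z. 0 < h i (prod_encode (x, w)) \<and>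
      sdrop b (h i (prod_encode (x, w)) - 1) = seq_nth (psnd z) i)" for b z x i
  define S where "S n b z \<longleftrightarrow> (2::nat) ^ f n \<le> (\<Sum>j<2 ^ f n. of_bool (\<forall>i\<in>P. conv b z (2 ^ f n - 1 + j) i))
      * 2 ^ (card P * (k + (n - b)))" for n b z
  have S_iff: "S n b z \<longleftrightarrow> 2 ^ f n \<le> card {s. length s = f n \<and> (\<forall>i\<in>P. conv b z (str_encode s) i)}
      * 2 ^ (card P * (k + (n - b)))" for n b z
    unfolding S_def sum_codes_of_length[where N = "f n" and Q = "\<lambda>x. \<forall>i\<in>P. conv b z x i"] ..
  have conv: "(\<exists>t. \<Gamma> i s = Some t \<and> str_encode (drop b t) = seq_nth u i) \<longleftrightarrow> (\<exists>m. \<forall>m'\<ge>m. conv b (prod_encode (m', u)) (str_encode s) i)"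
    "conv b z (str_encode s) i \<Longrightarrow> (\<exists>t. \<Gamma> i s = Some t \<and> str_encode (drop b t) = seq_nth (psnd z) i)"
    if "b \<le> n" "i \<in> P" "length s = f n" for n b i s u z
  proof -
    have len: "b \<le> length t" if "\<Gamma> i s = Some t" for t
      using length_\<Gamma>[of s n i t] \<open>length s = f n\<close> \<open>i \<in> P\<close> \<open>b \<le> n\<close> P that by auto
    have *: "\<exists>t. \<Gamma> i s = Some t \<and> str_encode (drop b t) = seq_nth (psnd z) i"
      if c: "conv b z (str_encode s) i" for z
    proof -
      from c obtain w where w: "0 < h i (prod_encode (str_encode s, w))"
        "sdrop b (h i (prod_encode (str_encode s, w)) - 1) = seq_nth (psnd z) i" unfolding conv_def by blast
      obtain t where t: "h i (prod_encode (str_encode s, w)) - 1 = str_encode t" by (rule str_encode_surj)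
      then have "h i (prod_encode (str_encode s, w)) = Suc (str_encode t)" using w(1) by simp
      then have "\<Gamma> i s = Some t" using h(2)[OF \<open>i \<in> P\<close>] by blast
      then show ?thesis using w(2) len t by auto
    qed
    then show "conv b z (str_encode s) i \<Longrightarrow> (\<exists>t. \<Gamma> i s = Some t \<and> str_encode (drop b t) = seq_nth (psnd z) i)" .
    show "(\<exists>t. \<Gamma> i s = Some t \<and> str_encode (drop b t) = seq_nth u i) \<longleftrightarrow> (\<exists>m. \<forall>m'\<ge>m. conv b (prod_encode (m', u)) (str_encode s) i)"
    proof
      assume "\<exists>t. \<Gamma> i s = Some t \<and> str_encode (drop b t) = seq_nth u i"
      then obtain t where t: "\<Gamma> i s = Some t" "str_encode (drop b t) = seq_nth u i" by blast
      then obtain w where w: "h i (prod_encode (str_encode s, w)) = Suc (str_encode t)" using h(2)[OF \<open>i \<in> P\<close>] by blast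
      have "conv b (prod_encode (m', u)) (str_encode s) i" if "m' \<ge> Suc w" for m'
        unfolding conv_def using that w t len by (intro exI[of _ w]) auto
      then show "\<exists>m. \<forall>m'\<ge>m. conv b (prod_encode (m', u)) (str_encode s) i" by blast
    next
      assume "\<exists>m. \<forall>m'\<ge>m. conv b (prod_encode (m', u)) (str_encode s) i"
      then show "\<exists>t. \<Gamma> i s = Some t \<and> str_encode (drop b t) = seq_nth u i" using * by fastforce
    qed
  qed
  have S_heavy: "heavy P n b (psnd z)" if "S n b z" "b \<le> n" for n b z
  proof -
    have "{s. length s = f n \<and> (\<forall>i\<in>P. conv b z (str_encode s) i)} \<subseteq> cell P n b (psnd z)"
      unfolding cell_def using conv(2) \<open>b \<le> n\<close> by blast
    from card_mono[OF finite_cell this] show ?thesis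
      using that(1) unfolding heavy_def S_iff by (meson le_trans mult_le_mono1)
  qed
  have heavy_S: "\<exists>z. S n b z" if "heavy P n b u" "b \<le> n" for n b u
  proof -
    have "\<exists>m. \<forall>m'\<ge>m. conv b (prod_encode (m', u)) (str_encode s) i" if "s \<in> cell P n b u" "i \<in> P" for s i
      using that conv(1)[OF \<open>b \<le> n\<close>] unfolding cell_def by blast
    then obtain m where m: "\<And>s i m'. s \<in> cell P n b u \<Longrightarrow> i \<in> P \<Longrightarrow> m s i \<le> m' \<Longrightarrow> conv b (prod_encode (m', u)) (str_encode s) i"
      by metis
    \<comment> \<open>The sum bounds all stages \<open>m s i\<close>, so the whole cell is
      recognised at stage \<open>M\<close>.\<close>
    define M where "M = (\<Sum>s\<in>cell P n b u. \<Sum>i\<in>P. m s i)"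
    have "m s i \<le> M" if "s \<in> cell P n b u" "i \<in> P" for s i
    proof -
      have "m s i \<le> (\<Sum>i\<in>P. m s i)" using that fin by (intro member_le_sum) auto
      also have "\<dots> \<le> M" unfolding M_def using that finite_cell by (intro member_le_sum[of s _ "\<lambda>s. \<Sum>i\<in>P. m s i"]) auto
      finally show ?thesis .
    qed
    then have "cell P n b u \<subseteq> {s. length s = f n \<and> (\<forall>i\<in>P. conv b (prod_encode (M, u)) (str_encode s) i)}"
      using m by (auto simp: cell_def)
    then have "card (cell P n b u) \<le> card {s. length s = f n \<and> (\<forall>i\<in>P. conv b (prod_encode (M, u)) (str_encode s) i)}"
      by (rule card_mono[rotated]) (rule finite_subset[OF _ card_strings_length(1)[of "f n"]], auto)
    then have "S n b (prod_encode (M, u))" using that(1) unfolding heavy_def S_iff by (meson le_trans mult_le_mono1)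
    then show ?thesis ..
  qed
  have th: "i \<in> P \<Longrightarrow> total_computable g \<Longrightarrow> total_computable (\<lambda>x. h i (g x))" for i g
    using tc_comp[OF h(1)] .
  \<comment> \<open>The string argument has a double role: its length supplies \<open>b\<close>, and
    its bits are the first \<open>b\<close> bits of the output. The cell found supplies the
    remaining bits.\<close>
  define F where "F i y = (if \<exists>z. S (pfst y) (slen (psnd y)) z
      then Some (sapp (psnd y) (seq_nth (psnd (LEAST z. S (pfst y) (slen (psnd y)) z)) i)) else None)" for i y
  have "partial_recursive (F i)" for i
    unfolding F_def[abs_def] S_def[abs_def] conv_def[abs_def]
    by (rule pr_search_out) (intro tc_str tc_seq_nth th dc_finite_ball fin tc_comp[OF tc_f] | assumption)+
  then have "\<forall>i. \<exists>c. \<forall>n v t. F i (prod_encode (n, str_encode v)) = Some (str_encode t) \<longrightarrow> C t \<le> length v + 2 * slen n + c"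
    using complexity_le_conditional by blast
  then obtain c where c: "\<And>i n v t. F i (prod_encode (n, str_encode v)) = Some (str_encode t) \<Longrightarrow> C t \<le> length v + 2 * slen n + c i"
    by metis
  define c0 where "c0 = (\<Sum>i\<in>P. c i)"
  have "\<exists>u. heavy P n b u \<and> (\<forall>i\<in>P. \<forall>t. length t = n \<longrightarrow> str_encode (drop b t) = seq_nth u i \<longrightarrow> C t \<le> b + 2 * slen n + c0)"
    if "b \<le> n" "heavy P n b u" for n b u
  proof -
    have ex: "\<exists>z. S n b z" using heavy_S that by blast
    define u where "u = psnd (LEAST z. S n b z)"
    have "heavy P n b u" unfolding u_def using S_heavy[OF LeastI_ex[OF ex] \<open>b \<le> n\<close>] .
    moreover have "C t \<le> b + 2 * slen n + c0" if t: "i \<in> P" "length t = n" "str_encode (drop b t) = seq_nth u i" for i t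
    proof -
      have "length (take b t) = b" using t \<open>b \<le> n\<close> by simp
      then have "F i (prod_encode (n, str_encode (take b t))) = Some (str_encode t)"
        using ex by (simp add: F_def flip: u_def t(3))
      from c[OF this] have "C t \<le> b + 2 * slen n + c i" using \<open>length (take b t) = b\<close> by simp
      moreover have "c i \<le> c0" unfolding c0_def using t(1) fin by (intro member_le_sum) auto
      ultimately show ?thesis by simp
    qed
    ultimately show ?thesis by blast
  qed
  then show ?thesis by blast
qed


text \<open>Each input that meets a convergence outside \<open>P\<close> is labelled with one such
  function and the end of its output. There are at most \<open>k * 2 ^ (n - b)\<close> labels, and
  the inputs with the most frequent label lie in a cell for one more function.\<close>

lemma heavy_extend:
  assumes P: "P \<subseteq> {1..k}" and "heavy P n b u" and b: "b \<le> n"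
    and many: "card (cell P n b u) < 2 * card {s \<in> cell P n b u. \<exists>i\<in>{1..k} - P. \<Gamma> i s \<noteq> None}"
  obtains i u' where "i \<in> {1..k} - P" "heavy (insert i P) n b u'"
proof -
  define T where "T = {s \<in> cell P n b u. \<exists>i\<in>{1..k} - P. \<Gamma> i s \<noteq> None}"
  have fT: "finite T" unfolding T_def using finite_cell by simp
  have "T \<noteq> {}" using many[folded T_def] by auto
  have "\<forall>s\<in>T. \<exists>i. i \<in> {1..k} - P \<and> \<Gamma> i s \<noteq> None" unfolding T_def by blast
  then obtain j where j: "\<And>s. s \<in> T \<Longrightarrow> j s \<in> {1..k} - P" "\<And>s. s \<in> T \<Longrightarrow> \<Gamma> (j s) s \<noteq> None" by metis
  define g where "g s = (j s, drop b (the (\<Gamma> (j s) s)))" for s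
  let ?B = "({1..k} - P) \<times> {r :: bool list. length r = n - b}"
  have fB: "finite ?B" using card_strings_length(1) by blast
  have gB: "g ` T \<subseteq> ?B"
  proof (rule image_subsetI)
    fix s assume s: "s \<in> T"
    then obtain t where t: "\<Gamma> (j s) s = Some t" using j(2) by blast
    have "length t = n" using length_\<Gamma>[OF _ _ t] j(1)[OF s] s by (auto simp: T_def cell_def)
    then show "g s \<in> ?B" using t j(1)[OF s] by (simp add: g_def)
  qed
  obtain y where y: "y \<in> ?B" "card T \<le> card {s \<in> T. g s = y} * card ?B"
    using pigeonhole_fibre[OF fT fB gB \<open>T \<noteq> {}\<close>] .
  obtain i r where ir: "y = (i, r)" by (cases y)
  \<comment> \<open>All indices are at most \<open>k\<close>, so prescribing the first
    \<open>k + 1\<close> entries suffices.\<close>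
  obtain u' where u': "\<forall>l<Suc k. seq_nth u' l = ((seq_nth u)(i := str_encode r)) l" using seq_nth_surj by blast
  have "{s \<in> T. g s = y} \<subseteq> cell (insert i P) n b u'"
  proof safe
    fix s assume s: "s \<in> T" "y = g s"
    then have js: "j s = i" "r = drop b (the (\<Gamma> i s))" by (auto simp: g_def ir)
    then obtain t where t: "\<Gamma> i s = Some t" using j(2)[OF s(1)] by blast
    have "seq_nth u' l = seq_nth u l" if "l \<in> P" for l
    proof -
      have "l \<le> k" "l \<noteq> i" using that P y(1) ir by auto
      then show ?thesis using u' by simp
    qed
    moreover have "seq_nth u' i = str_encode r" using u' y(1) ir by simp
    ultimately show "s \<in> cell (insert i P) n b u'" using s(1) t js by (auto simp: T_def cell_def)
  qed
  then have "card {s \<in> T. g s = y} \<le> card (cell (insert i P) n b u')" by (rule card_mono[OF finite_cell])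
  moreover have "card ?B \<le> k * 2 ^ (n - b)"
  proof -
    have "card ({1..k} - P) \<le> k" using card_mono[of "{1..k}" "{1..k} - P"] by simp
    then show ?thesis by (simp add: card_cartesian_product card_strings_length)
  qed
  ultimately have "card T \<le> card (cell (insert i P) n b u') * (k * 2 ^ (n - b))"
    using y(2) by (meson le_trans mult_le_mono)
  then have "card (cell P n b u) \<le> card (cell (insert i P) n b u') * (2 * k * 2 ^ (n - b))"
    using many unfolding T_def by simp
  also have "\<dots> \<le> card (cell (insert i P) n b u') * 2 ^ (k + (n - b))"
  proof -
    have "2 * k \<le> 2 ^ k" using k
    proof (induction k rule: dec_induct)
      case (step m)
      then show ?case using self_le_power[of 2 m] by simp
    qed simp
    then show ?thesis by (simp add: power_add)
  qed
  finally have le: "card (cell P n b u) \<le> card (cell (insert i P) n b u') * 2 ^ (k + (n - b))" .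
  have "card (insert i P) = Suc (card P)"
    using y(1) ir P finite_subset[OF P] by (subst card_insert_disjoint) auto
  then have "card (cell (insert i P) n b u') * 2 ^ (k + (n - b)) * 2 ^ (card P * (k + (n - b)))
      = card (cell (insert i P) n b u') * 2 ^ (card (insert i P) * (k + (n - b)))" by (simp add: power_add)
  then have "heavy (insert i P) n b u'"
    using \<open>heavy P n b u\<close> mult_le_mono1[OF le, of "2 ^ (card P * (k + (n - b)))"]
    unfolding heavy_def by linarith
  moreover have "i \<in> {1..k} - P" using y(1) ir by simp
  ultimately show ?thesis using that by blast
qed

text \<open>The condition on \<open>b\<close> puts all outputs in a computable heavy cell below the
  complexity that extraction demands. Half of the inputs of a maximal heavy cell have no other
  outputs, hence are simple. A heavy cell is large while there are few simple strings, which bounds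
  \<open>f n\<close>.\<close>

lemma input_length_bound:
  "\<exists>c. \<forall>n b. b \<le> n \<longrightarrow> b + 2 * slen n + real c < \<beta> * n - d \<longrightarrow>
    f n \<le> nat \<lceil>\<alpha> * f n\<rceil> + d + 1 + k * (k + (n - b))"
proof -
  have "\<forall>P\<in>Pow {1..k}. \<exists>c. \<forall>n b. b \<le> n \<longrightarrow> (\<exists>u. heavy P n b u) \<longrightarrow> (\<exists>u. heavy P n b u \<and>
    (\<forall>i\<in>P. \<forall>t. length t = n \<longrightarrow> str_encode (drop b t) = seq_nth u i \<longrightarrow> C t \<le> b + 2 * slen n + c))"
    using heavy_cell_computable by blast
  then obtain c where c: "\<And>P n b u. \<lbrakk>P \<subseteq> {1..k}; b \<le> n; heavy P n b u\<rbrakk> \<Longrightarrow> \<exists>u. heavy P n b u \<and>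
    (\<forall>i\<in>P. \<forall>t. length t = n \<longrightarrow> str_encode (drop b t) = seq_nth u i \<longrightarrow> C t \<le> b + 2 * slen n + c P)"
    unfolding bchoice_iff by (auto simp: Pow_def) metis
  define c0 where "c0 = (\<Sum>P\<in>Pow {1..k}. c P)"
  have "f n \<le> nat \<lceil>\<alpha> * f n\<rceil> + d + 1 + k * (k + (n - b))"
    if b: "b \<le> n" and small: "b + 2 * slen n + real c0 < \<beta> * n - d" for n b
  proof -
    \<comment> \<open>The empty set qualifies with the cell of all strings of length
      \<open>f n\<close>, and sizes are at most \<open>k\<close>, so a \<open>P\<close> of maximal
      size exists.\<close>
    let ?good = "\<lambda>P. P \<subseteq> {1..k} \<and> (\<exists>u. heavy P n b u)"
    have e: "?good {}" by (simp add: heavy_def cell_def card_strings_length)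
    have le: "\<forall>P. ?good P \<longrightarrow> card P < Suc k"
      using card_mono[of "{1..k}"] by (force simp: less_Suc_eq_le)
    from ex_has_greatest_nat[of ?good, OF e le] obtain P where P: "P \<subseteq> {1..k}" "\<exists>u. heavy P n b u" and max: "\<And>Q. ?good Q \<Longrightarrow> card Q \<le> card P"
      by blast
    \<comment> \<open>The arbitrary heavy cell is exchanged for the computable one;
      \<open>P\<close>, and with it the maximality, is unchanged.\<close>
    from P(2) obtain u0 where "heavy P n b u0" ..
    from c[OF P(1) b this] obtain u where u: "heavy P n b u"
      "\<And>i t. \<lbrakk>i \<in> P; length t = n; str_encode (drop b t) = seq_nth u i\<rbrakk> \<Longrightarrow> C t \<le> b + 2 * slen n + c P"
      by blast
    let ?T = "cell P n b u" and ?T' = "{s \<in> cell P n b u. \<exists>i\<in>{1..k} - P. \<Gamma> i s \<noteq> None}"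
    have half: "2 * card ?T' \<le> card ?T"
    proof (rule ccontr)
      assume "\<not> ?thesis"
      then obtain i u' where i: "i \<in> {1..k} - P" "heavy (insert i P) n b u'"
        using heavy_extend[OF P(1) u(1) b] by (auto simp: not_le)
      then have "?good (insert i P)" using P(1) by auto
      then have "card (insert i P) \<le> card P" by (rule max)
      then show False using i(1) finite_subset[OF P(1)] by simp
    qed
    define m where "m = nat \<lceil>\<alpha> * f n\<rceil> + d"
    have "C s < m" if s: "s \<in> ?T - ?T'" for s
    proof (rule ccontr)
      assume "\<not> C s < m"
      then have "\<alpha> * f n + d \<le> C s" unfolding m_def by linarith
      moreover have "length s = f n" using s by (simp add: cell_def)
      ultimately obtain i t where it: "i \<in> {1..k}" "\<Gamma> i s = Some t" "\<beta> * n - d \<le> C t" using extracts by blast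
      have "i \<in> P" using s it by blast
      then have "C t \<le> b + 2 * slen n + c P"
        using s it length_\<Gamma>[OF \<open>length s = f n\<close> it(1,2)] by (intro u(2)[of i]) (auto simp: cell_def)
      moreover have "c P \<le> c0" unfolding c0_def using P(1) by (intro member_le_sum) auto
      ultimately have "real (C t) \<le> b + 2 * slen n + c0" by linarith
      with it(3) small show False by simp
    qed
    then have "?T - ?T' \<subseteq> {s. C s < m}" by blast
    then have "card (?T - ?T') \<le> card {s. C s < m}" by (rule card_mono[OF card_low_complexity(1)])
    then have "card (?T - ?T') < 2 ^ m" using card_low_complexity(2)[of m] by linarith
    moreover have "card (?T - ?T') = card ?T - card ?T'" using finite_cell by (intro card_Diff_subset) auto
    ultimately have "card ?T < 2 ^ (m + 1)" using half by simp
    then have "2 ^ f n < 2 ^ (m + 1) * (2::nat) ^ (card P * (k + (n - b)))"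
      using u(1) unfolding heavy_def by (meson le_less_trans mult_less_mono1 zero_less_numeral zero_less_power)
    also have "\<dots> \<le> 2 ^ (m + 1) * 2 ^ (k * (k + (n - b)))"
      using card_mono[OF _ P(1)] by (intro mult_le_mono le_refl power_increasing) auto
    also have "\<dots> = 2 ^ (m + 1 + k * (k + (n - b)))" by (simp add: power_add)
    finally have "f n < m + 1 + k * (k + (n - b))" by (rule power_less_imp_less_exp[rotated]) simp
    then show ?thesis by (simp add: m_def)
  qed
  then show ?thesis by blast
qed

end

section \<open>Necessity\<close>

text \<open>Logarithmic errors are weakened to square roots, which are still of smaller order than
  \<open>n\<close> and have simple values at squares and powers of 4.\<close>

lemma slen_le_sqrt:
  assumes "1 \<le> n"
  shows "real (slen n) \<le> 2 * sqrt n"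
proof -
  obtain s where s: "n = str_encode s" by (rule str_encode_surj)
  have sq: "l\<^sup>2 \<le> 2 * (2::nat) ^ l" for l
  proof (cases "l < 3")
    case True
    then have "l = 0 \<or> l = 1 \<or> l = 2" by auto
    then show ?thesis by auto
  next
    case False
    then have "3 \<le> l" by simp
    then show ?thesis
    proof (induction l rule: dec_induct)
      case (step m)
      have "3 * m \<le> m * m" using step by (intro mult_le_mono1) simp
      then have "2 * m + 1 \<le> m\<^sup>2" using step(1) unfolding power2_eq_square by linarith
      then show ?case using step by (simp add: power2_eq_square)
    qed simp
  qed
  have "(slen n)\<^sup>2 \<le> 2 * 2 ^ slen n" by (rule sq)
  also have "\<dots> \<le> 2 * (n + 1)" using str_encode_bounds[of s] s by simp
  also have "\<dots> \<le> 4 * n" using assms by simp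
  finally have "real ((slen n)\<^sup>2) \<le> real (4 * n)" by (simp only: of_nat_le_iff)
  then have "real (slen n) \<le> sqrt (4 * n)" by (intro real_le_rsqrt) simp
  then show ?thesis by (simp add: real_sqrt_mult)
qed

lemma linear_le_sqrt_imp_nonpos:
  fixes x c :: real
  assumes "\<And>n. n \<ge> n0 \<Longrightarrow> x * real n \<le> c * sqrt (real n)"
  shows "x \<le> 0"
proof (rule ccontr)
  assume "\<not> x \<le> 0"
  then have x: "x > 0" by simp
  obtain m where m: "c / x < real m" using reals_Archimedean2 by blast
  \<comment> \<open>At the square \<open>l * l\<close> the assumption becomes
    \<open>x * l \<le> c\<close>, which fails because \<open>l\<close> exceeds
    \<open>c / x\<close>.\<close>
  define l where "l = m + n0 + 1"
  have "l * 1 \<le> l * l" by (intro mult_le_mono2) (simp add: l_def)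
  moreover have "n0 \<le> l" by (simp add: l_def)
  ultimately have "n0 \<le> l * l" by linarith
  from assms[OF this] have "x * l * l \<le> c * l" by simp
  then have "x * l \<le> c" by (simp add: l_def)
  then have "real l \<le> c / x" using x by (simp add: pos_le_divide_eq mult.commute)
  with m show False by (simp add: l_def)
qed

lemma computable_realI:
  assumes "total_computable a" "total_computable b" "\<And>t. 0 < b t" "\<And>t. \<bar>x - real (a t) / real (b t)\<bar> \<le> 1 / 2 ^ t"
  shows "computable_real x"
  unfolding computable_real_def
proof (rule exI[of _ "\<lambda>t. 2 * a t"], rule exI[of _ "\<lambda>t. b t - 1"], intro conjI allI)
  show "total_computable (\<lambda>t. 2 * a t)" "total_computable (\<lambda>t. b t - 1)"
    using assms(1,2) by (intro tc_rules; simp)+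
  fix t
  \<comment> \<open>Even codes stand for the nonnegative integers; \<open>b t - 1\<close>
    compensates for the \<open>Suc\<close> in the denominator of
    \<open>computable_real\<close>.\<close>
  have "int_decode (2 * a t) = int (a t)" by (simp add: int_decode_def sum_decode_def)
  then show "\<bar>x - of_int (int_decode (2 * a t)) / real (Suc (b t - 1))\<bar> \<le> 1 / 2 ^ t" using assms(3,4)[of t] by simp
qed

lemma computable_real_Rats:
  assumes "x \<in> \<rat>" "0 \<le> x"
  shows "computable_real x"
proof -
  obtain m n :: nat where mn: "n \<noteq> 0" "\<bar>x\<bar> = m / n" using Rats_abs_nat_div_natE[OF assms(1)] by blast
  then show ?thesis using assms(2) by (intro computable_realI[of "\<lambda>_. m" "\<lambda>_. n"] tc_const) auto
qed

context extractor
begin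

text \<open>An injective function takes values below \<open>B\<close> only finitely often.\<close>

lemma eventually_f_ge: "\<exists>n0. \<forall>n\<ge>n0. B \<le> f n"
proof -
  have "finite (f -` {..<B})" using inj_f by (intro finite_vimageI) auto
  then obtain n0 where "\<forall>n\<in>f -` {..<B}. n < n0" using finite_nat_set_iff_bounded by blast
  then have "\<forall>n\<ge>n0. B \<le> f n" by (meson lessThan_iff not_le vimageI)
  then show ?thesis ..
qed

text \<open>For large \<open>n\<close> the side conditions of both bounds are met:
  \<open>\<alpha> < 1\<close> leaves room for the random part of the input, and
  \<open>0 < \<beta>\<close> allows \<open>b\<close> to fall short of \<open>\<beta> * n\<close> by
  a logarithmic amount.\<close>

lemma rate_bounds:
  assumes "\<alpha> < 1" "0 < \<beta>"
  shows "\<exists>c\<ge>0. \<exists>n0\<ge>1. \<forall>n\<ge>n0. \<beta> * n \<le> \<alpha> * f n + c * sqrt n \<and>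
    (1 - \<alpha>) * f n \<le> k * (1 - \<beta>) * n + c * sqrt n"
proof -
  obtain c1 where c1: "\<And>n. nat \<lceil>\<alpha> * f n\<rceil> + d \<le> f n \<Longrightarrow> \<beta> * n \<le> \<alpha> * f n + 2 * slen n + real c1"
    using output_rate_bound by blast
  obtain c2 where c2: "\<And>n b. b \<le> n \<Longrightarrow> b + 2 * slen n + real c2 < \<beta> * n - d \<Longrightarrow>
      f n \<le> nat \<lceil>\<alpha> * f n\<rceil> + d + 1 + k * (k + (n - b))" using input_length_bound by blast
  \<comment> \<open>From \<open>n1\<close> on, \<open>\<alpha> * f n + d + 1 \<le> f n\<close>; the
    1 allows for rounding up.\<close>
  obtain n1 where n1: "\<And>n. n \<ge> n1 \<Longrightarrow> nat \<lceil>(d + 1) / (1 - \<alpha>)\<rceil> \<le> f n" using eventually_f_ge by blast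
  \<comment> \<open>The summand 4 of \<open>e\<close> comes from
    \<open>2 * slen n \<le> 4 * sqrt n\<close>, the rest from the constants. From \<open>n2\<close>
    on, \<open>e * sqrt n \<le> \<beta> * n\<close>.\<close>
  define e where "e = 5 + real (c2 + d)"
  define n2 where "n2 = nat \<lceil>(e / \<beta>)\<^sup>2\<rceil>"
  define K where "K = 2 + real d + real k * k + real k * (5 + c2 + d)"
  define c where "c = (4 + real c1) + K"
  have le: "0 \<le> K" unfolding K_def by (auto intro!: add_nonneg_nonneg)
  have A: "\<beta> * n \<le> \<alpha> * f n + c * sqrt n" if "n \<ge> max 1 (max n1 n2)" for n
  proof -
    have "1 \<le> n" "n \<ge> n1" using that by auto
    have s1: "1 \<le> sqrt n" using \<open>1 \<le> n\<close> by simp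
    have "(d + 1) / (1 - \<alpha>) \<le> f n" using n1[OF \<open>n \<ge> n1\<close>] by linarith
    then have "d + 1 \<le> (1 - \<alpha>) * f n" using assms(1) by (simp add: pos_divide_le_eq mult.commute)
    then have "\<alpha> * f n + 1 + d \<le> f n" by (simp add: algebra_simps)
    moreover have "0 \<le> \<alpha> * f n" using \<alpha> by simp
    ultimately have "nat \<lceil>\<alpha> * f n\<rceil> + d \<le> f n" by linarith
    from c1[OF this] have "\<beta> * n \<le> \<alpha> * f n + 2 * slen n + real c1" .
    also have "2 * real (slen n) + c1 \<le> (4 + real c1) * sqrt n"
      using slen_le_sqrt[OF \<open>1 \<le> n\<close>] s1 mult_left_mono[of 1 "sqrt n" "real c1"] by (simp add: algebra_simps)
    then have "\<alpha> * f n + 2 * slen n + real c1 \<le> \<alpha> * f n + (4 + real c1) * sqrt n" by simp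
    also have "\<dots> \<le> \<alpha> * f n + c * sqrt n" unfolding c_def using le s1 by (simp add: algebra_simps)
    finally show ?thesis .
  qed
  have B: "(1 - \<alpha>) * f n \<le> k * (1 - \<beta>) * n + c * sqrt n" if "n \<ge> max 1 (max n1 n2)" for n
  proof -
    have n: "1 \<le> n" "n \<ge> n2" using that by auto
    have s1: "1 \<le> sqrt n" using n by simp
    have sl: "slen n \<le> 2 * sqrt n" by (rule slen_le_sqrt[OF n(1)])
    have "(e / \<beta>)\<^sup>2 \<le> n" using n(2) unfolding n2_def by linarith
    then have "e / \<beta> \<le> sqrt n" by (rule real_le_rsqrt)
    then have "e \<le> \<beta> * sqrt n" using assms(2) by (simp add: pos_divide_le_eq mult.commute)
    then have "e * sqrt n \<le> \<beta> * sqrt n * sqrt n" using s1 by (intro mult_right_mono) auto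
    then have "e * sqrt n \<le> \<beta> * n" by (simp add: mult.assoc)
    moreover have "4 * sqrt n + c2 + d + 1 \<le> e * sqrt n"
      unfolding e_def using s1 mult_left_mono[OF s1, of "1 + real (c2 + d)"] by (simp add: algebra_simps)
    ultimately have big: "2 * slen n + c2 + d + 1 \<le> \<beta> * n" using sl by linarith
    \<comment> \<open>The largest \<open>b\<close> that \<open>c2\<close> admits; the final 1 keeps
      the inequality strict after rounding \<open>\<beta> * n\<close> up.\<close>
    define b where "b = nat (\<lceil>\<beta> * n\<rceil> - int (2 * slen n + c2 + d + 1))"
    have "int (2 * slen n + c2 + d + 1) \<le> \<lceil>\<beta> * n\<rceil>" using big by linarith
    then have b: "real b = \<lceil>\<beta> * n\<rceil> - real (2 * slen n + c2 + d + 1)" unfolding b_def by simp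
    have ceil: "\<beta> * n \<le> \<lceil>\<beta> * n\<rceil>" "\<lceil>\<beta> * n\<rceil> < \<beta> * n + 1" by linarith+
    have "b + 2 * slen n + real c2 < \<beta> * n - d" using ceil(2) unfolding of_nat_add b by simp
    moreover have "b \<le> n"
    proof -
      have "\<beta> * n \<le> n" using \<beta> by (simp add: mult_left_le_one_le)
      then show ?thesis using ceil(2) b by linarith
    qed
    ultimately have "f n \<le> nat \<lceil>\<alpha> * f n\<rceil> + d + 1 + k * (k + (n - b))" using c2 by blast
    then have "real (f n) \<le> real (nat \<lceil>\<alpha> * f n\<rceil> + d + 1 + k * (k + (n - b)))" by (simp only: of_nat_le_iff)
    also have "\<dots> = real (nat \<lceil>\<alpha> * f n\<rceil>) + d + 1 + k * (k + (real n - b))" using \<open>b \<le> n\<close> by (simp add: of_nat_diff)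
    also have "\<dots> \<le> (\<alpha> * f n + 1) + d + 1 + k * (k + (real n - b))"
    proof -
      have "0 \<le> \<alpha> * f n" using \<alpha> by simp
      then have "real (nat \<lceil>\<alpha> * f n\<rceil>) \<le> \<alpha> * f n + 1" by linarith
      then show ?thesis by simp
    qed
    finally have "(1 - \<alpha>) * f n \<le> 2 + d + k * (k + (real n - b))" by (simp add: algebra_simps)
    also have "\<dots> \<le> 2 + d + k * (k + ((1 - \<beta>) * n + (4 * sqrt n + c2 + d + 1)))"
    proof -
      have "real n - b \<le> (1 - \<beta>) * n + (4 * sqrt n + c2 + d + 1)"
        unfolding left_diff_distrib using b ceil(1) sl by linarith
      then have "k * (k + (real n - b)) \<le> k * (k + ((1 - \<beta>) * n + (4 * sqrt n + c2 + d + 1)))"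
        by (intro mult_left_mono) auto
      then show ?thesis by simp
    qed
    also have "\<dots> = k * (1 - \<beta>) * n + (2 + d + real k * k + k * (4 * sqrt n + c2 + d + 1))"
      by (simp add: algebra_simps)
    also have "2 + d + real k * k + k * (4 * sqrt n + c2 + d + 1) \<le> K * sqrt n"
    proof -
      have "k * (4 * sqrt n + c2 + d + 1) \<le> k * ((5 + c2 + d) * sqrt n)"
        using mult_left_mono[OF s1, of "1 + real c2 + d"] by (intro mult_left_mono) (auto simp: algebra_simps)
      moreover have "2 + d + real k * k \<le> (2 + d + real k * k) * sqrt n"
        using mult_left_mono[OF s1, of "2 + d + real k * k"] by simp
      ultimately show ?thesis unfolding K_def by (simp add: algebra_simps)
    qed
    also have "K * sqrt n \<le> c * sqrt n" unfolding c_def using s1 by (intro mult_right_mono) auto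
    finally show ?thesis by simp
  qed
  have "0 \<le> c" using le by (simp add: c_def)
  then show ?thesis using A B by (intro exI[of _ c] conjI exI[of _ "max 1 (max n1 n2)"]) auto
qed

text \<open>The first rate bound times \<open>1 - \<alpha>\<close> and the second times
  \<open>\<alpha>\<close> together eliminate \<open>f n\<close>. What remains bounds a multiple of
  \<open>n\<close> by a square root, so its coefficient is not positive.\<close>

lemma necessary_inequality: "\<beta> * (1 + (real k - 1) * \<alpha>) \<le> k * \<alpha>"
proof (cases "\<alpha> = 1 \<or> \<beta> = 0")
  case True
  then show ?thesis using \<alpha> \<beta> k by (auto simp: mult_left_le_one_le)
next
  case False
  then have "\<alpha> < 1" "0 < \<beta>" using \<alpha> \<beta> by auto
  obtain c :: real and n0 :: nat where c: "0 \<le> c" "1 \<le> n0"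
    "\<And>n. n \<ge> n0 \<Longrightarrow> \<beta> * n \<le> \<alpha> * f n + c * sqrt n"
    "\<And>n. n \<ge> n0 \<Longrightarrow> (1 - \<alpha>) * f n \<le> k * (1 - \<beta>) * n + c * sqrt n" using rate_bounds[OF \<open>\<alpha> < 1\<close> \<open>0 < \<beta>\<close>] by blast
  have "\<beta> * (1 - \<alpha>) - \<alpha> * k * (1 - \<beta>) \<le> 0"
  proof (rule linear_le_sqrt_imp_nonpos)
    fix n assume n: "n \<ge> n0"
    have "(1 - \<alpha>) * (\<beta> * n) \<le> (1 - \<alpha>) * (\<alpha> * f n + c * sqrt n)"
      using c(3)[OF n] \<open>\<alpha> < 1\<close> by (intro mult_left_mono) auto
    also have "\<dots> = \<alpha> * ((1 - \<alpha>) * f n) + (1 - \<alpha>) * (c * sqrt n)" by (simp add: algebra_simps)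
    also have "\<dots> \<le> \<alpha> * (k * (1 - \<beta>) * n + c * sqrt n) + (1 - \<alpha>) * (c * sqrt n)"
      using c(4)[OF n] \<alpha> by (intro add_right_mono mult_left_mono) auto
    finally show "(\<beta> * (1 - \<alpha>) - \<alpha> * k * (1 - \<beta>)) * n \<le> c * sqrt n" by (simp add: algebra_simps)
  qed
  then show ?thesis by (simp add: algebra_simps)
qed

text \<open>On the curve the two rate bounds confine \<open>f n / n\<close> from both sides to an
  error of order \<open>1 / sqrt n\<close> around \<open>\<beta> / \<alpha>\<close>. Since
  \<open>k \<ge> 2\<close>, both numbers can be recovered from this quotient.\<close>

lemma equality_computable:
  assumes "2 \<le> k" and eq: "\<beta> * (1 + (real k - 1) * \<alpha>) = k * \<alpha>"
  shows "computable_real \<alpha>" "computable_real \<beta>"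
proof -
  consider "\<alpha> = 0" | "\<alpha> = 1" | "0 < \<alpha>" "\<alpha> < 1" using \<alpha> by fastforce
  then have "computable_real \<alpha> \<and> computable_real \<beta>"
  proof cases
    case 1
    then show ?thesis using eq computable_real_Rats[of 0] by simp
  next
    case 2
    then show ?thesis using eq computable_real_Rats[of 1] assms(1) by simp
  next
    case 3
    have pos: "0 < 1 + (real k - 1) * \<alpha>" using 3 assms(1) by (intro add_pos_nonneg) auto
    have "0 < \<beta>"
    proof (rule ccontr)
      assume "\<not> 0 < \<beta>"
      then have "\<beta> = 0" using \<beta> by simp
      then show False using eq 3 assms(1) by simp
    qed
    obtain c :: real and n0 :: nat where c: "0 \<le> c" "1 \<le> n0"
      "\<And>n. n \<ge> n0 \<Longrightarrow> \<beta> * n \<le> \<alpha> * f n + c * sqrt n"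
      "\<And>n. n \<ge> n0 \<Longrightarrow> (1 - \<alpha>) * f n \<le> k * (1 - \<beta>) * n + c * sqrt n" using rate_bounds[OF 3(2) \<open>0 < \<beta>\<close>] by blast
    \<comment> \<open>\<open>r\<close> is \<open>\<beta> / \<alpha>\<close>, and equality makes it
      also \<open>k * (1 - \<beta>) / (1 - \<alpha>)\<close>; so both rate bounds have the same
      limit.\<close>
    define r where "r = k - (real k - 1) * \<beta>"
    have r: "\<alpha> * r = \<beta>" "(1 - \<alpha>) * r = k * (1 - \<beta>)" using eq by (simp_all add: r_def algebra_simps)
    have "(real k - 1) * \<beta> \<le> real k - 1" using \<beta> assms(1) by (simp add: mult_right_le_one_le)
    then have "1 \<le> r" by (simp add: r_def)
    define c' where "c' = c / \<alpha> + c / (1 - \<alpha>)"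
    \<comment> \<open>\<open>2 ^ e\<close> exceeds both \<open>2 * k * c'\<close> and
      \<open>n0\<close>. At \<open>n = 4 ^ (t + e)\<close> the error \<open>c' / sqrt n\<close> is
      then at most \<open>1 / 2 ^ t\<close>, even after multiplication by \<open>2 * k\<close>, a
      reserve used for \<open>\<alpha>\<close>.\<close>
    obtain e where e: "2 * k * (c' + 1) + n0 < 2 ^ e" using real_arch_pow[of 2] by auto
    define N where "N t = (4::nat) ^ (t + e)" for t
    have Npos: "0 < N t" for t by (simp add: N_def)
    have c'0: "0 \<le> c'" using c(1) 3 by (simp add: c'_def)
    have N0: "n0 \<le> N t" for t
    proof -
      have "real n0 \<le> 2 ^ e" using e c'0 by (smt (verit) mult_nonneg_nonneg of_nat_0_le_iff)
      also have "\<dots> \<le> 4 ^ (t + e)" by (rule order_trans[OF power_mono power_increasing[of e "t + e"]]) auto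
      finally show ?thesis unfolding N_def by (metis of_nat_le_iff of_nat_numeral of_nat_power)
    qed
    have sqrtN: "sqrt (N t) = 2 ^ (t + e)" for t
      by (rule real_sqrt_unique) (auto simp: N_def power2_eq_square simp flip: power_mult_distrib)
    define q where "q t = real (f (N t)) / N t" for t
    have qr: "2 * k * \<bar>q t - r\<bar> \<le> 1 / 2 ^ t" for t
    proof -
      let ?n = "N t"
      have "\<alpha> * (r * ?n) \<le> \<alpha> * (f ?n + c / \<alpha> * sqrt ?n)"
        using c(3)[OF N0[of t]] 3 by (simp add: algebra_simps flip: r(1))
      then have "r * ?n \<le> f ?n + c / \<alpha> * sqrt ?n" using 3(1) by (simp only: mult_le_cancel_left_pos)
      moreover have "(1 - \<alpha>) * f ?n \<le> (1 - \<alpha>) * (r * ?n + c / (1 - \<alpha>) * sqrt ?n)"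
      proof -
        have "(1 - \<alpha>) * (c / (1 - \<alpha>) * sqrt ?n) = c * sqrt ?n" using 3 by simp
        then show ?thesis using c(4)[OF N0[of t]] unfolding r(2)[symmetric] distrib_left[of "1 - \<alpha>"]
          by (simp only: mult.assoc)
      qed
      then have "f ?n \<le> r * ?n + c / (1 - \<alpha>) * sqrt ?n" using 3(2) by (simp only: mult_le_cancel_left_pos diff_gt_0_iff_gt)
      moreover have "0 \<le> c / \<alpha> * sqrt ?n" "0 \<le> c / (1 - \<alpha>) * sqrt ?n" using c(1) 3 by simp_all
      ultimately have "\<bar>f ?n - r * ?n\<bar> \<le> c' * sqrt ?n" by (simp add: c'_def algebra_simps)
      moreover have "f ?n - r * ?n = (q t - r) * ?n" using Npos[of t] by (simp add: q_def field_simps)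
      ultimately have "\<bar>q t - r\<bar> * ?n \<le> c' * sqrt ?n" by (simp add: abs_mult)
      then have "\<bar>q t - r\<bar> * sqrt ?n * sqrt ?n \<le> c' * sqrt ?n" by (simp add: mult.assoc)
      then have "\<bar>q t - r\<bar> * sqrt ?n \<le> c'" using Npos[of t] by simp
      then have "2 * k * (\<bar>q t - r\<bar> * sqrt ?n) \<le> 2 * k * c'" by (intro mult_left_mono) auto
      also have "\<dots> \<le> 2 ^ e" using e by (simp add: algebra_simps)
      finally have "2 * k * \<bar>q t - r\<bar> * 2 ^ t * 2 ^ e \<le> 1 * 2 ^ e" by (simp add: sqrtN power_add mult.assoc)
      then have "2 * k * \<bar>q t - r\<bar> * 2 ^ t \<le> 1" by (rule mult_right_le_imp_le) simp
      then show ?thesis by (simp add: pos_le_divide_eq)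
    qed
    have q1: "\<bar>q t - r\<bar> \<le> 1 / 2 ^ t" "1 / 2 \<le> q t" for t
    proof -
      have "1 * \<bar>q t - r\<bar> \<le> (2 * k) * \<bar>q t - r\<bar>" using assms(1) by (intro mult_right_mono) auto
      from order_trans[OF this qr[of t]] show "\<bar>q t - r\<bar> \<le> 1 / 2 ^ t" by simp
      have "2 * \<bar>q t - r\<bar> \<le> (2 * k) * \<bar>q t - r\<bar>" using assms(1) by (intro mult_right_mono) auto
      also note qr[of t]
      also have "1 / 2 ^ t \<le> (1::real)" by simp
      finally have "2 * \<bar>q t - r\<bar> \<le> 1" .
      then have "\<bar>q t - r\<bar> \<le> 1 / 2" by simp
      then have "r - q t \<le> 1 / 2" by (rule order_trans[rotated]) (rule abs_ge_minus_self[of "q t - r", simplified])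
      then show "1 / 2 \<le> q t" using \<open>1 \<le> r\<close> by simp
    qed
    have fpos: "0 < f (N t)" for t
    proof (rule ccontr)
      assume "\<not> 0 < f (N t)"
      then show False using q1(2)[of t] by (simp add: q_def)
    qed
    \<comment> \<open>The numerators below use truncated subtraction; cutting off at 0 cannot
      increase the distance to a nonnegative number.\<close>
    have nonneg: "\<bar>x - max 0 y\<bar> \<le> \<bar>x - y\<bar>" if "0 \<le> x" for x y :: real using that by linarith
    have tcN: "total_computable N" unfolding N_def[abs_def] by (intro tc_rules)
    have num: "real (k * N t - f (N t)) = max 0 (real k * N t - f (N t))" for t
    proof -
      have "real (a - b) = max 0 (real a - real b)" for a b :: nat by (cases "b \<le> a") (auto simp: of_nat_diff)
      from this[of "k * N t" "f (N t)"] show ?thesis by simp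
    qed
    have "computable_real \<beta>"
    proof (rule computable_realI[of "\<lambda>t. k * N t - f (N t)" "\<lambda>t. (k - 1) * N t"])
      show "total_computable (\<lambda>t. k * N t - f (N t))" "total_computable (\<lambda>t. (k - 1) * N t)"
        by (intro tc_rules tc_comp[OF tc_f] tcN)+
      fix t
      show "0 < (k - 1) * N t" using Npos assms(1) by simp
      have "real (k * N t - f (N t)) / real ((k - 1) * N t) = max 0 ((real k * N t - f (N t)) / real ((k - 1) * N t))"
        unfolding num by (simp add: max_divide_distrib_right)
      also have "(real k * N t - f (N t)) / real ((k - 1) * N t) = (k - q t) / (real k - 1)"
        using Npos[of t] assms(1) by (simp add: q_def field_simps of_nat_diff)
      finally have "\<bar>\<beta> - real (k * N t - f (N t)) / real ((k - 1) * N t)\<bar> \<le> \<bar>\<beta> - (k - q t) / (real k - 1)\<bar>"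
        using nonneg[of \<beta>] \<beta> by simp
      also have "\<beta> - (k - q t) / (real k - 1) = (q t - r) / (real k - 1)"
        using assms(1) by (simp add: r_def field_simps)
      also have "\<bar>(q t - r) / (real k - 1)\<bar> = \<bar>q t - r\<bar> / (real k - 1)" using assms(1) by simp
      also have "\<dots> \<le> \<bar>q t - r\<bar> / 1" using assms(1) by (intro divide_left_mono) auto
      also have "\<dots> \<le> 1 / 2 ^ t" using q1(1)[of t] by simp
      finally show "\<bar>\<beta> - real (k * N t - f (N t)) / real ((k - 1) * N t)\<bar> \<le> 1 / 2 ^ t" .
    qed
    moreover have "computable_real \<alpha>"
    proof (rule computable_realI[of "\<lambda>t. k * N t - f (N t)" "\<lambda>t. (k - 1) * f (N t)"])
      show "total_computable (\<lambda>t. k * N t - f (N t))" "total_computable (\<lambda>t. (k - 1) * f (N t))"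
        by (intro tc_rules tc_comp[OF tc_f] tcN)+
      have \<alpha>_eq: "\<alpha> = (k / r - 1) / (real k - 1)"
      proof -
        have "\<alpha> = \<beta> / r" using r(1) \<open>1 \<le> r\<close> by (simp add: field_simps)
        also have "\<beta> = (k - r) / (real k - 1)" using assms(1) by (simp add: r_def field_simps)
        finally show ?thesis using \<open>1 \<le> r\<close> by (simp add: field_simps)
      qed
      fix t
      show "0 < (k - 1) * f (N t)" using fpos assms(1) by simp
      have "real (k * N t - f (N t)) / real ((k - 1) * f (N t)) = max 0 ((real k * N t - f (N t)) / real ((k - 1) * f (N t)))"
        unfolding num by (simp add: max_divide_distrib_right)
      also have "(real k * N t - f (N t)) / real ((k - 1) * f (N t)) = (k / q t - 1) / (real k - 1)"
        using Npos[of t] fpos[of t] assms(1) by (simp add: q_def field_simps of_nat_diff)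
      finally have "\<bar>\<alpha> - real (k * N t - f (N t)) / real ((k - 1) * f (N t))\<bar> \<le> \<bar>\<alpha> - (k / q t - 1) / (real k - 1)\<bar>"
        using nonneg[of \<alpha>] \<alpha> by simp
      also have "\<alpha> - (k / q t - 1) / (real k - 1) = k * (q t - r) / ((real k - 1) * (r * q t))"
      proof -
        have "r \<noteq> 0" "q t \<noteq> 0" using \<open>1 \<le> r\<close> q1(2)[of t] by auto
        then have "k / r - k / q t = k * (q t - r) / (r * q t)" by (simp add: field_simps)
        then show ?thesis unfolding \<alpha>_eq by (simp add: mult.commute flip: diff_divide_distrib)
      qed
      also have "\<bar>\<dots>\<bar> = k * \<bar>q t - r\<bar> / ((real k - 1) * (r * q t))"
        using assms(1) \<open>1 \<le> r\<close> q1(2)[of t] by (simp add: abs_mult)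
      \<comment> \<open>The denominator is at least \<open>1 / 2\<close>, as
        \<open>k \<ge> 2\<close>, \<open>r \<ge> 1\<close> and \<open>q t \<ge> 1 / 2\<close>; the
        resulting factor \<open>2 * k\<close> is covered by \<open>qr\<close>.\<close>
      also have "\<dots> \<le> k * \<bar>q t - r\<bar> / (1 / 2)"
      proof (rule divide_left_mono)
        have "1 * (1 * (1 / 2)) \<le> (real k - 1) * (r * q t)"
          using assms(1) \<open>1 \<le> r\<close> q1(2)[of t] by (intro mult_mono) auto
        then show "1 / 2 \<le> (real k - 1) * (r * q t)" by simp
        then show "0 < (real k - 1) * (r * q t) * (1 / 2)" by linarith
      qed simp
      also have "\<dots> \<le> 1 / 2 ^ t" using qr[of t] by simp
      finally show "\<bar>\<alpha> - real (k * N t - f (N t)) / real ((k - 1) * f (N t))\<bar> \<le> 1 / 2 ^ t" .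
    qed
    ultimately show ?thesis by blast
  qed
  then show "computable_real \<alpha>" "computable_real \<beta>" by auto
qed

end

section \<open>Sufficiency\<close>

text \<open>The \<open>n\<close>-th approximation of \<open>x\<close> errs by at most
  \<open>1 / 2 ^ n\<close>, hence its \<open>n\<close>-th multiple by at most 1, and rounding adds
  at most 1. As \<open>x\<close> lies between 0 and 1, steps of 0 and 1 suffice to follow this
  sequence.\<close>

lemma computable_multiples:
  assumes "computable_real x" "x \<in> {0..1}"
  obtains b where "total_computable b" "b 0 = 0" "\<And>n. b (Suc n) = b n \<or> b (Suc n) = Suc (b n)"
    "\<And>n. \<bar>real (b n) - x * n\<bar> \<le> 3"
proof -
  obtain p q where pq: "total_computable p" "total_computable q"
    "\<And>n. \<bar>x - of_int (int_decode (p n)) / real (Suc (q n))\<bar> \<le> 1 / 2 ^ n"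
    using assms(1) unfolding computable_real_def by blast
  \<comment> \<open>Odd codes stand for negative integers; replacing them by 0 is harmless because
    \<open>x\<close> is nonnegative.\<close>
  define u where "u n = (if p n mod 2 = 0 then p n div 2 else 0)" for n
  have u: "real (u n) = max 0 (of_int (int_decode (p n)))" for n
    by (auto simp: u_def int_decode_def sum_decode_def even_iff_mod_2_eq_zero)
  define a where "a n = (u n * n) div Suc (q n)" for n
  have tc_a: "total_computable a"
    unfolding a_def u_def by (intro tc_rules pq)
  have a: "\<bar>real (a n) - x * n\<bar> \<le> 2" for n
  proof -
    define y where "y = u n / real (Suc (q n))"
    have "y = max 0 (of_int (int_decode (p n)) / real (Suc (q n)))"
      unfolding y_def u by (simp add: max_divide_distrib_right)
    then have "\<bar>x - y\<bar> \<le> \<bar>x - of_int (int_decode (p n)) / real (Suc (q n))\<bar>" using assms(2) by auto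
    with pq(3)[of n] have "\<bar>x - y\<bar> \<le> 1 / 2 ^ n" by linarith
    then have "\<bar>x - y\<bar> * n \<le> 1 / 2 ^ n * n" by (intro mult_right_mono) auto
    also have "\<dots> \<le> 1" using of_nat_less_two_power[of n, where 'a = real] by (simp add: field_simps)
    finally have "\<bar>x * n - y * n\<bar> \<le> 1" by (simp add: abs_mult flip: left_diff_distrib)
    moreover have "y * n = real (u n * n) / real (Suc (q n))" by (simp add: y_def)
    then have "a n = \<lfloor>y * n\<rfloor>" by (simp only: a_def floor_divide_of_nat_eq)
    then have "\<bar>real (a n) - y * n\<bar> \<le> 1" by linarith
    ultimately show ?thesis by linarith
  qed
  \<comment> \<open>With increments 0 and 1, \<open>n - b n\<close> is monotone, which later makes the input length injective.\<close>
  define b where "b n = rec_nat 0 (\<lambda>j r. if r < a (Suc j) then Suc r else r) n" for n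
  have b_Suc: "b (Suc n) = (if b n < a (Suc n) then Suc (b n) else b n)" for n by (simp add: b_def)
  show ?thesis
  proof (rule that)
    show "total_computable b" unfolding b_def
      by (intro tc_rec_nat tc_rules tc_comp[OF tc_a])
    show "b 0 = 0" by (simp add: b_def)
    show "b (Suc n) = b n \<or> b (Suc n) = Suc (b n)" for n by (simp add: b_Suc)
    show "\<bar>real (b n) - x * n\<bar> \<le> 3" for n
    proof (induction n)
      case (Suc n)
      have s: "x * n \<le> x * Suc n" "x * Suc n \<le> x * n + 1" using assms(2) by (auto simp: algebra_simps)
      show ?case
      proof (cases "b n < a (Suc n)")
        case True
        then have "real (b (Suc n)) = b n + 1" "real (b n) + 1 \<le> a (Suc n)" by (auto simp: b_Suc)
        then show ?thesis using a[of "Suc n"] s Suc by linarith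
      next
        case False
        then have "real (b (Suc n)) = b n" "a (Suc n) \<le> real (b n)" by (auto simp: b_Suc)
        then show ?thesis using a[of "Suc n"] s Suc by linarith
      qed
    qed (simp add: b_def)
  qed
qed

primrec opt_iter :: "(nat \<rightharpoonup> nat) \<Rightarrow> nat \<Rightarrow> nat \<rightharpoonup> nat" where
  "opt_iter g 0 z = Some z"
| "opt_iter g (Suc j) z = Option.bind (opt_iter g j z) g"

text \<open>Decompression has to undo the last compression first, so the first step of an iteration
  must be split off as well as the last.\<close>

lemma opt_iter_Suc_left: "opt_iter g (Suc j) z = Option.bind (g z) (opt_iter g j)"
proof (induction j arbitrary: z)
  case (Suc j)
  have "opt_iter g (Suc (Suc j)) z = Option.bind (opt_iter g (Suc j) z) g" by simp
  also have "\<dots> = Option.bind (g z) (\<lambda>y. Option.bind (opt_iter g j y) g)" by (simp only: Suc bind_assoc)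
  finally show ?case by simp
next
  case 0
  show ?case by (cases "g z") auto
qed

lemma pr_opt_iter: "partial_recursive g \<Longrightarrow> partial_recursive (opt_iter g j)"
proof (induction j)
  case 0
  have "opt_iter g 0 = Some" by (simp add: fun_eq_iff)
  then show ?case using tc_id by (simp add: total_computable_def)
next
  case (Suc j)
  then have "partial_recursive (\<lambda>z. Option.bind (opt_iter g j z) g)" by (intro partial_recursive.comp)
  then show ?case by (rule back_subst[where P = partial_recursive]) (simp add: fun_eq_iff)
qed

section \<open>Compressing prefixes of the input\<close>

locale compression = optimal +
  fixes k :: nat and b :: "nat \<Rightarrow> nat" and g :: "nat \<rightharpoonup> nat" and h :: "nat \<Rightarrow> nat"
  assumes k: "1 \<le> k" and tc_b: "total_computable b" and b0: "b 0 = 0"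
    and b_Suc: "\<And>n. b (Suc n) = b n \<or> b (Suc n) = Suc (b n)"
    and g: "partial_recursive g" "\<And>s. g (str_encode s) = map_option str_encode (U s)"
    and h: "total_computable h" "\<And>x y. g x = Some y \<longleftrightarrow> (\<exists>w. h (prod_encode (x, w)) = Suc y)"
begin

text \<open>Each compression shortens the string by \<open>n - b n\<close>, so after
  \<open>k - 1\<close> of them exactly the \<open>n\<close> bits for the last candidate
  remain.\<close>

definition input_length :: "nat \<Rightarrow> nat" where "input_length n = n + (k - 1) * (n - b n)"

lemma b_le: "b n \<le> n"
proof (induction n)
  case (Suc n)
  then show ?case using b_Suc[of n] by auto
qed (simp add: b0)

lemma tc_input_length: "total_computable input_length"
  unfolding input_length_def by (intro tc_rules tc_comp[OF tc_b])

lemma inj_input_length: "inj input_length"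
proof -
  have "input_length n < input_length (Suc n)" for n
  proof -
    have "n - b n \<le> Suc n - b (Suc n)" using b_Suc[of n] b_le[of n] by auto
    then have "(k - 1) * (n - b n) \<le> (k - 1) * (Suc n - b (Suc n))" by (rule mult_le_mono2)
    then show ?thesis unfolding input_length_def by linarith
  qed
  then have "strict_mono input_length" by (simp add: strict_mono_Suc_iff)
  then show ?thesis by (rule strict_mono_imp_inj_on)
qed

text \<open>A state is a pair of the output length \<open>n\<close> and a string. A compression step replaces the first
  \<open>n\<close> bits of the string by a \<open>U\<close>-program for them, padded to length \<open>b n\<close>.\<close>

definition found :: "nat \<Rightarrow> nat \<Rightarrow> bool" where
  "found z w \<longleftrightarrow> slen (pfst w) = b (pfst z) \<and>
     h (prod_encode (str_body (pfst w), psnd w)) = Suc (stake (pfst z) (psnd z))"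

definition compress :: "nat \<rightharpoonup> nat" where
  "compress z = (if \<exists>w. found z w
     then Some (prod_encode (pfst z, sapp (pfst (LEAST w. found z w)) (sdrop (pfst z) (psnd z)))) else None)"

definition expand :: "nat \<rightharpoonup> nat" where
  "expand z = Option.bind (g (str_body (stake (b (pfst z)) (psnd z))))
     (\<lambda>t. Some (prod_encode (pfst z, sapp t (sdrop (b (pfst z)) (psnd z)))))"

definition start :: "nat \<rightharpoonup> nat" where
  "start x = (if \<exists>n. input_length n = slen x
     then Some (prod_encode (LEAST n. input_length n = slen x, x)) else None)"

definition candidate :: "nat \<Rightarrow> nat \<rightharpoonup> nat" where
  "candidate j x = Option.bind (Option.bind (start x) (opt_iter compress j)) (\<lambda>z. Some (stake (pfst z) (psnd z)))"

text \<open>After \<open>k\<close> compressions \<open>b n\<close> bits remain, and their number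
  determines only the level set of \<open>b\<close> that contains \<open>n\<close>. The first
  component tells how far \<open>n\<close> is from its least element.\<close>

definition restart :: "nat \<rightharpoonup> nat" where
  "restart z = (if \<exists>n. b n = slen (psnd z)
     then Some (prod_encode ((LEAST n. b n = slen (psnd z)) + pfst z, psnd z)) else None)"

definition decompress :: "nat \<rightharpoonup> nat" where
  "decompress z = Option.bind (Option.bind (restart z) (opt_iter expand k)) (\<lambda>z. Some (psnd z))"

lemma pr_compress: "partial_recursive compress"
  unfolding compress_def[abs_def] found_def[abs_def]
  by (rule pr_search_out) (intro tc_str tc_str_body tc_comp[OF h(1)] tc_comp[OF tc_b])+

lemma pr_expand: "partial_recursive expand"
proof -
  have "partial_recursive (\<lambda>z. g (str_body (stake (b (pfst z)) (psnd z))))"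
    by (rule pr_total_comp[OF _ g(1)]) (intro tc_str tc_str_body tc_comp[OF tc_b])
  note p = partial_recursive.pair[OF this tc_id[unfolded total_computable_def]]
  have "total_computable (\<lambda>y. prod_encode (pfst (psnd y), sapp (pfst y) (sdrop (b (pfst (psnd y))) (psnd (psnd y)))))"
    by (intro tc_str tc_comp[OF tc_b])
  from partial_recursive.comp[OF this[unfolded total_computable_def] p] show ?thesis
    by (rule back_subst[where P = partial_recursive]) (simp add: fun_eq_iff expand_def)
qed

lemma pr_candidate: "partial_recursive (candidate j)"
proof -
  have "partial_recursive start" unfolding start_def[abs_def]
    by (rule pr_search_out) (intro tc_str tc_comp[OF tc_input_length])+
  moreover have "partial_recursive (\<lambda>z. Some (stake (pfst z) (psnd z)))"
    unfolding total_computable_def[symmetric] by (intro tc_str)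
  ultimately show ?thesis unfolding candidate_def[abs_def]
    by (intro partial_recursive.comp pr_opt_iter pr_compress)
qed

lemma pr_decompress: "partial_recursive decompress"
proof -
  have "partial_recursive restart" unfolding restart_def[abs_def]
    by (rule pr_search_out) (intro tc_str tc_comp[OF tc_b])+
  moreover have "partial_recursive (\<lambda>z. Some (psnd z))"
    unfolding total_computable_def[symmetric] by (intro tc_str)
  ultimately show ?thesis unfolding decompress_def[abs_def]
    by (intro partial_recursive.comp pr_opt_iter pr_expand)
qed

lemma expand_compress:
  assumes "n \<le> length s" "compress (prod_encode (n, str_encode s)) = Some z"
  obtains t where "z = prod_encode (n, str_encode t)" "length t + (n - b n) = length s"
    "expand z = Some (prod_encode (n, str_encode s))"
proof -
  let ?z = "prod_encode (n, str_encode s)"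
  define w where "w = (LEAST w. found ?z w)"
  have ex: "\<exists>w. found ?z w" using assms(2) by (auto simp: compress_def split: if_splits)
  then have w: "found ?z w" unfolding w_def by (rule LeastI_ex)
  obtain p where p: "pfst w = str_encode p" by (rule str_encode_surj)
  have len: "length p = b n" using w by (simp add: found_def p)
  have "h (prod_encode (str_body (str_encode p), psnd w)) = Suc (str_encode (take n s))"
    using w assms(1) by (simp add: found_def p)
  then have gp: "g (str_body (str_encode p)) = Some (str_encode (take n s))" using h(2) by blast
  define t where "t = p @ drop n s"
  have z: "z = prod_encode (n, str_encode t)"
    using assms ex by (simp add: compress_def p t_def flip: w_def)
  have "expand z = Some (prod_encode (n, str_encode s))"
    using gp sdrop_stake_encode_append[of p "drop n s"] by (simp add: expand_def z t_def len)
  moreover have "length t + (n - b n) = length s" using assms(1) b_le[of n] by (simp add: t_def len)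
  ultimately show ?thesis using that z by blast
qed

lemma compress_defined:
  assumes "n \<le> length s" "C (take n s) < b n"
  shows "compress (prod_encode (n, str_encode s)) \<noteq> None"
proof -
  obtain p where p: "U p = Some (take n s)" "length p = C (take n s)" using complexity_witness by blast
  \<comment> \<open>The strict inequality leaves room for the bit that ends the padding.\<close>
  define p' where "p' = replicate (b n - length p - 1) False @ True # p"
  have "g (str_encode p) = Some (str_encode (take n s))" using p(1) by (simp add: g(2))
  then obtain w where "h (prod_encode (str_encode p, w)) = Suc (str_encode (take n s))" using h(2) by blast
  then have "found (prod_encode (n, str_encode s)) (prod_encode (str_encode p', w))"
    using assms p(2) by (simp add: found_def p'_def)
  then show ?thesis by (auto simp: compress_def)
qed

lemma iterate_compress:
  assumes "length s = input_length n" "j \<le> k" "opt_iter compress j (prod_encode (n, str_encode s)) = Some z"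
  obtains t where "z = prod_encode (n, str_encode t)" "length t + j * (n - b n) = input_length n"
    "opt_iter expand j z = Some (prod_encode (n, str_encode s))"
  using assms(2,3)
proof (induction j arbitrary: z thesis)
  case 0
  then show ?case using assms(1) by simp
next
  case (Suc j)
  from Suc.prems(3) obtain y where y: "opt_iter compress j (prod_encode (n, str_encode s)) = Some y" "compress y = Some z"
    by (auto simp: bind_eq_Some_conv)
  obtain t where t: "y = prod_encode (n, str_encode t)" "length t + j * (n - b n) = input_length n"
    "opt_iter expand j y = Some (prod_encode (n, str_encode s))"
    using Suc.IH[OF _ _ y(1)] Suc.prems(2) by auto
  \<comment> \<open>Before each of the \<open>k\<close> compressions at least \<open>n\<close> bits
    are left, so the prefix to be replaced is complete.\<close>
  have "j * (n - b n) \<le> (k - 1) * (n - b n)" using Suc.prems(2) by (intro mult_le_mono1) simp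
  then have "n \<le> length t" using t(2) unfolding input_length_def by linarith
  from expand_compress[OF this y(2)[unfolded t(1)]] obtain r where
    r: "z = prod_encode (n, str_encode r)" "length r + (n - b n) = length t" "expand z = Some (prod_encode (n, str_encode t))" .
  show ?case
  proof (rule Suc.prems(1)[OF r(1)])
    show "length r + Suc j * (n - b n) = input_length n" using r(2) t(2) by simp
    show "opt_iter expand (Suc j) z = Some (prod_encode (n, str_encode s))"
      unfolding opt_iter_Suc_left r(3) using t(1,3) by simp
  qed
qed

lemma start_eq: "length s = input_length n \<Longrightarrow> start (str_encode s) = Some (prod_encode (n, str_encode s))"
proof -
  assume s: "length s = input_length n"
  have "(LEAST m. input_length m = input_length n) = n"
    using inj_input_length by (intro Least_equality) (auto simp: inj_eq)
  then show ?thesis using s by (auto simp: start_def)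
qed

lemma candidate_eq:
  assumes "length s = input_length n" "j < k" "opt_iter compress j (prod_encode (n, str_encode s)) = Some z"
  obtains t where "z = prod_encode (n, str_encode t)" "n \<le> length t" "candidate j (str_encode s) = Some (str_encode (take n t))"
proof -
  obtain t where t: "z = prod_encode (n, str_encode t)" "length t + j * (n - b n) = input_length n"
    using iterate_compress[OF assms(1) _ assms(3)] assms(2) by auto
  have "j * (n - b n) \<le> (k - 1) * (n - b n)" using assms(2) by (intro mult_le_mono1) simp
  then have n: "n \<le> length t" using t(2) unfolding input_length_def by linarith
  moreover have "candidate j (str_encode s) = Some (str_encode (take n t))"
    using start_eq[OF assms(1)] assms(3) t(1) n by (simp add: candidate_def)
  ultimately show ?thesis using that t(1) by blast
qed

lemma candidate_length:
  assumes "length s = input_length n" "j < k" "candidate j (str_encode s) = Some (str_encode r)"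
  shows "length r = n"
proof -
  obtain z where z: "opt_iter compress j (prod_encode (n, str_encode s)) = Some z"
    using assms(3) start_eq[OF assms(1)] by (auto simp: candidate_def bind_eq_Some_conv)
  then obtain t where "n \<le> length t" "candidate j (str_encode s) = Some (str_encode (take n t))"
    using candidate_eq[OF assms(1,2) z] by blast
  then show ?thesis using assms(3) by auto
qed

text \<open>If every candidate is simple, all \<open>k\<close> compressions succeed, and the
  remaining \<open>b n\<close> bits determine the input once \<open>n\<close> is known. The
  assumption bounds the level sets of \<open>b\<close>, so \<open>n\<close> costs at most
  \<open>K\<close> bits of unary advice.\<close>

lemma complexity_le_of_candidates:
  assumes width: "\<And>m n. b m = b n \<Longrightarrow> n \<le> m + K"
  shows "\<exists>c. \<forall>n s. length s = input_length n \<longrightarrow>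
    (\<forall>j<k. \<forall>r. candidate j (str_encode s) = Some (str_encode r) \<longrightarrow> C r < b n) \<longrightarrow> C s \<le> b n + c"
proof -
  obtain c where c: "\<And>a v t. decompress (prod_encode (a, str_encode v)) = Some (str_encode t) \<Longrightarrow> C t \<le> length v + a + c"
    using complexity_le_unary_advice[OF pr_decompress] by blast
  have "C s \<le> b n + (K + c)" if s: "length s = input_length n"
    and low: "\<And>j r. j < k \<Longrightarrow> candidate j (str_encode s) = Some (str_encode r) \<Longrightarrow> C r < b n" for n s
  proof -
    have "j \<le> k \<Longrightarrow> opt_iter compress j (prod_encode (n, str_encode s)) \<noteq> None" for j
    proof (induction j)
      case (Suc j)
      then obtain z where z: "opt_iter compress j (prod_encode (n, str_encode s)) = Some z" by auto
      from Suc.prems have "j < k" by simp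
      from candidate_eq[OF s this z] obtain t where t: "z = prod_encode (n, str_encode t)" "n \<le> length t"
        "candidate j (str_encode s) = Some (str_encode (take n t))" .
      have "C (take n t) < b n" using low[OF \<open>j < k\<close> t(3)] .
      from compress_defined[OF t(2) this] show ?case using z t(1) by auto
    qed simp
    then obtain z where z: "opt_iter compress k (prod_encode (n, str_encode s)) = Some z" by blast
    obtain v where v: "z = prod_encode (n, str_encode v)" "length v + k * (n - b n) = input_length n"
      "opt_iter expand k z = Some (prod_encode (n, str_encode s))"
      using iterate_compress[OF s le_refl z] .
    have "k * (n - b n) = (k - 1) * (n - b n) + (n - b n)" using k by (cases k) auto
    then have len: "length v = b n" using v(2) b_le[of n] unfolding input_length_def by linarith
    define m where "m = (LEAST m. b m = b n)"
    have m: "b m = b n" "m \<le> n" unfolding m_def by (rule LeastI[of _ n], rule refl) (rule Least_le, rule refl)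
    have "restart (prod_encode (n - m, str_encode v)) = Some z"
      using m(2) by (auto simp: restart_def len v(1) simp flip: m_def)
    then have "decompress (prod_encode (n - m, str_encode v)) = Some (str_encode s)"
      using v(3) by (simp add: decompress_def)
    from c[OF this] have "C s \<le> b n + (n - m) + c" by (simp add: len)
    moreover have "n - m \<le> K" using width[OF m(1)] by simp
    ultimately show ?thesis by simp
  qed
  then show ?thesis by blast
qed

end

section \<open>Membership in \<open>EXTp\<close> and the characterisation\<close>

lemma EXTpI:
  fixes f :: "nat \<Rightarrow> nat" and \<Gamma> :: "nat \<Rightarrow> bool list \<rightharpoonup> bool list" and d :: nat
  assumes "\<alpha> \<in> {0..1}" "\<beta> \<in> {0..1}" "total_computable f" "inj f" "\<And>i. i \<in> {1..k} \<Longrightarrow> partial_computable (\<Gamma> i)"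
    "\<And>n s i t. length s = f n \<Longrightarrow> i \<in> {1..k} \<Longrightarrow> \<Gamma> i s = Some t \<Longrightarrow> length t = n"
    "\<And>n s. length s = f n \<Longrightarrow> \<alpha> * real (length s) + real d \<le> real (plain_complexity U s) \<Longrightarrow>
      \<exists>i\<in>{1..k}. \<exists>t. \<Gamma> i s = Some t \<and> \<beta> * real (length t) - real d \<le> real (plain_complexity U t)"
  shows "(\<alpha>, \<beta>) \<in> EXTp U k"
  unfolding EXTp_def mem_Collect_eq prod.case
  by (intro conjI exI[of _ f] exI[of _ \<Gamma>] exI[of _ d] allI impI ballI) (fact assms | erule (2) assms | erule (1) assms | erule assms)+

lemma EXTpE:
  assumes "(\<alpha>, \<beta>) \<in> EXTp U k"
  obtains f :: "nat \<Rightarrow> nat" and \<Gamma> :: "nat \<Rightarrow> bool list \<rightharpoonup> bool list" and d :: nat where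
    "total_computable f" "inj f" "\<And>i. i \<in> {1..k} \<Longrightarrow> partial_computable (\<Gamma> i)"
    "\<And>n s i t. length s = f n \<Longrightarrow> i \<in> {1..k} \<Longrightarrow> \<Gamma> i s = Some t \<Longrightarrow> length t = n"
    "\<And>n s. length s = f n \<Longrightarrow> \<alpha> * real (length s) + real d \<le> real (plain_complexity U s) \<Longrightarrow>
      \<exists>i\<in>{1..k}. \<exists>t. \<Gamma> i s = Some t \<and> \<beta> * real (length t) - real d \<le> real (plain_complexity U t)"
  using assms unfolding EXTp_def mem_Collect_eq prod.case by blast

text \<open>By the equation, \<open>\<alpha> * input_length n\<close> and \<open>b n\<close> differ
  by a bounded amount. An input on which all candidates are simple therefore has complexity below
  the threshold.\<close>

lemma (in optimal) boundary_extractable: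
  assumes k: "1 \<le> k" and \<alpha>: "0 < \<alpha>" "\<alpha> \<le> 1" and \<beta>: "\<beta> \<in> {0..1}" "computable_real \<beta>"
    and eq: "\<beta> * (1 + (real k - 1) * \<alpha>) = k * \<alpha>"
  shows "(\<alpha>, \<beta>) \<in> EXTp U k"
proof -
  obtain b where b: "total_computable b" "b 0 = 0" "\<And>n. b (Suc n) = b n \<or> b (Suc n) = Suc (b n)"
    and approx: "\<And>n. \<bar>real (b n) - \<beta> * n\<bar> \<le> 3" using computable_multiples[OF \<beta>(2,1)] by blast
  obtain g where g: "partial_recursive g" "\<And>s. g (str_encode s) = map_option str_encode (U s)"
    using optimal unfolding optimal_machine_def partial_computable_def by blast
  obtain h where h: "total_computable h" "\<And>x y. g x = Some y \<longleftrightarrow> (\<exists>w. h (prod_encode (x, w)) = Suc y)"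
    using partial_recursive_witness[OF g(1)] by blast
  interpret compression U k b g h by unfold_locales (use k b g h in auto)
  have "0 < \<beta>"
  proof (rule ccontr)
    assume "\<not> 0 < \<beta>"
    then have "\<beta> = 0" using \<beta> by simp
    then show False using eq \<alpha>(1) k by simp
  qed
  \<comment> \<open>Equal values of \<open>b\<close> put \<open>\<beta> * m\<close> and
    \<open>\<beta> * n\<close> within 6 of each other, 3 for each approximation; positive
    \<open>\<beta>\<close> makes this a bound on \<open>n\<close>.\<close>
  have width: "n \<le> m + nat \<lceil>6 / \<beta>\<rceil>" if "b m = b n" for m n
  proof -
    have "\<beta> * n \<le> \<beta> * m + 6" using approx[of m] approx[of n] that by linarith
    then have "\<beta> * (real n - m) \<le> 6" by (simp add: algebra_simps)
    then have "real n - m \<le> 6 / \<beta>" using \<open>0 < \<beta>\<close> by (simp add: pos_le_divide_eq mult.commute)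
    then show ?thesis by linarith
  qed
  obtain c where c: "\<And>n s. length s = input_length n \<Longrightarrow>
    (\<And>j r. j < k \<Longrightarrow> candidate j (str_encode s) = Some (str_encode r) \<Longrightarrow> C r < b n) \<Longrightarrow> C s \<le> b n + c"
    using complexity_le_of_candidates[OF width] by blast
  define \<Gamma> where "\<Gamma> i s = map_option (inv str_encode) (candidate (i - 1) (str_encode s))" for i s
  have \<Gamma>: "\<Gamma> i s = Some t \<longleftrightarrow> candidate (i - 1) (str_encode s) = Some (str_encode t)" for i s t
  proof (cases "candidate (i - 1) (str_encode s)")
    case (Some y)
    obtain r where "y = str_encode r" by (rule str_encode_surj)
    then show ?thesis using Some by (simp add: \<Gamma>_def)
  qed (simp add: \<Gamma>_def)
  \<comment> \<open>\<open>d\<close> absorbs the error of \<open>b n\<close>, its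
    \<open>k - 1\<close> occurrences in the input length, and the constant of decompression.\<close>
  define d where "d = 4 + 3 * k + c"
  have rate: "b n + c < \<alpha> * input_length n + d" for n
  proof -
    have "(real k - 1) * (real n - b n) \<ge> (real k - 1) * (real n - (\<beta> * n + 3))"
      using approx[of n] k by (intro mult_left_mono) auto
    then have "\<alpha> * (n + (real k - 1) * (real n - b n)) \<ge> \<alpha> * (n + (real k - 1) * (real n - (\<beta> * n + 3)))"
      using \<alpha> by (intro mult_left_mono) auto
    also have "\<alpha> * (n + (real k - 1) * (real n - (\<beta> * n + 3))) = (k * \<alpha> - \<beta> * (real k - 1) * \<alpha>) * n - 3 * (\<alpha> * (real k - 1))"
      by (simp add: algebra_simps)
    also have "k * \<alpha> - \<beta> * (real k - 1) * \<alpha> = \<beta>" using eq by (simp add: algebra_simps)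
    finally have "\<beta> * n - 3 * (\<alpha> * (real k - 1)) \<le> \<alpha> * (n + (real k - 1) * (real n - b n))" .
    moreover have "\<alpha> * (real k - 1) \<le> 1 * (real k - 1)" using \<alpha> k by (intro mult_right_mono) auto
    ultimately have "\<beta> * n - 3 * (real k - 1) \<le> \<alpha> * (n + (real k - 1) * (real n - b n))" by linarith
    moreover have "real (input_length n) = n + (real k - 1) * (real n - b n)"
      using k b_le[of n] by (simp add: input_length_def of_nat_diff)
    ultimately show ?thesis using approx[of n] by (simp add: d_def)
  qed
  have extracts: "\<exists>i\<in>{1..k}. \<exists>t. \<Gamma> i s = Some t \<and> \<beta> * length t - d \<le> C t"
    if s: "length s = input_length n" and high: "\<alpha> * length s + d \<le> C s" for n s
  proof (rule ccontr)
    assume no: "\<not> ?thesis"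
    have "C s \<le> b n + c"
    proof (rule c[OF s])
      fix j r assume j: "j < k" and r: "candidate j (str_encode s) = Some (str_encode r)"
      have len: "length r = n" by (rule candidate_length[OF s j r])
      have "\<Gamma> (Suc j) s = Some r" "Suc j \<in> {1..k}" using r j by (auto simp: \<Gamma>)
      then have "\<not> \<beta> * length r - d \<le> C r" using no by blast
      then have "real (C r) < b n" using approx[of n] len by (simp add: d_def)
      then show "C r < b n" by simp
    qed
    then show False using rate[of n] high s by simp
  qed
  have len: "length t = n" if "length s = input_length n" "i \<in> {1..k}" "\<Gamma> i s = Some t" for n s i t
  proof (rule candidate_length[OF that(1)])
    show "i - 1 < k" using that(2) by auto
    show "candidate (i - 1) (str_encode s) = Some (str_encode t)" using that(3) by (simp only: \<Gamma>)
  qed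
  have pc: "partial_computable (\<Gamma> i)" for i
    unfolding \<Gamma>_def[abs_def] by (rule partial_computable_of_recursive[OF pr_candidate])
  show ?thesis
  proof (rule EXTpI[of _ _ input_length k \<Gamma> d])
    show "\<alpha> \<in> {0..1}" using \<alpha> by simp
  qed (fact \<beta>(1) tc_input_length inj_input_length | rule pc | erule (2) len | erule (1) extracts)+
qed


lemma (in optimal) identity_extractable:
  assumes "1 \<le> k" "\<alpha> \<in> {0..1}" "\<beta> \<in> {0..1}" "\<beta> \<le> \<alpha>"
  shows "(\<alpha>, \<beta>) \<in> EXTp U k"
proof -
  have "partial_computable Some"
    unfolding partial_computable_def using tc_id by (auto simp: total_computable_def)
  moreover have "\<exists>i\<in>{1..k}. \<exists>t. Some s = Some t \<and> \<beta> * length t - real 0 \<le> C t"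
    if "\<alpha> * length s + real 0 \<le> C s" for s :: "bool list"
    using that mult_right_mono[OF assms(4), of "length s"] assms(1) by auto
  ultimately show ?thesis
    using assms(2,3) tc_id by (intro EXTpI[of _ _ "\<lambda>n. n" k "\<lambda>_. Some" 0]) auto
qed

lemma EXTp_mono:
  assumes "(\<alpha>', \<beta>') \<in> EXTp U k" "\<alpha>' \<le> \<alpha>" "\<beta> \<le> \<beta>'" "\<alpha> \<in> {0..1}" "\<beta> \<in> {0..1}"
  shows "(\<alpha>, \<beta>) \<in> EXTp U k"
proof -
  obtain f \<Gamma> d where *: "total_computable f" "inj f" "\<And>i. i \<in> {1..k} \<Longrightarrow> partial_computable (\<Gamma> i)"
    "\<And>n s i t. length s = f n \<Longrightarrow> i \<in> {1..k} \<Longrightarrow> \<Gamma> i s = Some t \<Longrightarrow> length t = n"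
    "\<And>n s. length s = f n \<Longrightarrow> \<alpha>' * real (length s) + real d \<le> real (plain_complexity U s) \<Longrightarrow>
      \<exists>i\<in>{1..k}. \<exists>t. \<Gamma> i s = Some t \<and> \<beta>' * real (length t) - real d \<le> real (plain_complexity U t)"
    using EXTpE[OF assms(1)] by blast
  have extracts: "\<exists>i\<in>{1..k}. \<exists>t. \<Gamma> i s = Some t \<and> \<beta> * real (length t) - real d \<le> real (plain_complexity U t)"
    if "length s = f n" "\<alpha> * real (length s) + real d \<le> real (plain_complexity U s)" for n s
  proof -
    have "\<alpha>' * real (length s) \<le> \<alpha> * real (length s)" using assms(2) by (intro mult_right_mono) auto
    with that *(5)[OF that(1)] obtain i t where it: "i \<in> {1..k}" "\<Gamma> i s = Some t"
      "\<beta>' * real (length t) - real d \<le> real (plain_complexity U t)" by fastforce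
    have "\<beta> * real (length t) \<le> \<beta>' * real (length t)" using assms(3) by (intro mult_right_mono) auto
    then show ?thesis using it by (intro bexI[of _ i] exI[of _ t]) auto
  qed
  show ?thesis by (rule EXTpI[OF assms(4,5) *(1-4) extracts])
qed

theorem theorem10:
  fixes U :: "bool list \<rightharpoonup> bool list" and k :: nat and \<alpha> \<beta> :: real
  assumes "optimal_machine U"
    and "k \<ge> 1"
    and "\<alpha> \<in> {0..1}" and "\<beta> \<in> {0..1}"
  shows "(\<alpha>, \<beta>) \<in> EXTp U k \<longleftrightarrow>
    (k = 1 \<and> \<beta> \<le> \<alpha>) \<or>
    (k \<ge> 2 \<and> \<beta> < real k * \<alpha> / (1 + (real k - 1) * \<alpha>)) \<or>
    (k \<ge> 2 \<and> \<beta> = real k * \<alpha> / (1 + (real k - 1) * \<alpha>) \<and> computable_real \<alpha> \<and> computable_real \<beta>)"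
proof -
  interpret optimal U by unfold_locales (rule assms(1))
  have pos: "0 < 1 + (real k - 1) * x" if "0 \<le> x" for x
    using that assms(2) by (intro add_pos_nonneg) auto
  note div_iff = pos_le_divide_eq[OF pos] pos_less_divide_eq[OF pos] nonzero_eq_divide_eq[OF pos[THEN less_imp_neq[THEN not_sym]]]
  have \<alpha>0: "0 \<le> \<alpha>" using assms(3) by simp
  show ?thesis
  proof
    assume "(\<alpha>, \<beta>) \<in> EXTp U k"
    then obtain f \<Gamma> d where ext: "total_computable f" "inj f" "\<And>i. i \<in> {1..k} \<Longrightarrow> partial_computable (\<Gamma> i)"
      "\<And>n s i t. length s = f n \<Longrightarrow> i \<in> {1..k} \<Longrightarrow> \<Gamma> i s = Some t \<Longrightarrow> length t = n"
      "\<And>n s. length s = f n \<Longrightarrow> \<alpha> * real (length s) + real d \<le> real (C s) \<Longrightarrow>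
        \<exists>i\<in>{1..k}. \<exists>t. \<Gamma> i s = Some t \<and> \<beta> * real (length t) - real d \<le> real (C t)"
      using EXTpE[of \<alpha> \<beta> U k] by blast
    interpret extractor U k f \<Gamma> d \<alpha> \<beta>
    proof
      show "\<exists>i\<in>{1..k}. \<exists>t. \<Gamma> i s = Some t \<and> \<beta> * real n - real d \<le> real (C t)"
        if "length s = f n" "\<alpha> * real (f n) + real d \<le> real (C s)" for n s
        using ext(5)[of s n] ext(4)[of s n] that by fastforce
    qed (fact ext(1,2) assms(2,3,4) | erule ext(3) | erule (2) ext(4))+
    show "(k = 1 \<and> \<beta> \<le> \<alpha>) \<or> (k \<ge> 2 \<and> \<beta> < real k * \<alpha> / (1 + (real k - 1) * \<alpha>)) \<or>
      (k \<ge> 2 \<and> \<beta> = real k * \<alpha> / (1 + (real k - 1) * \<alpha>) \<and> computable_real \<alpha> \<and> computable_real \<beta>)"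
    proof (cases "k = 1")
      case True
      then show ?thesis using necessary_inequality by simp
    next
      case False
      then have "2 \<le> k" using assms(2) by simp
      then show ?thesis
        using necessary_inequality equality_computable[OF \<open>2 \<le> k\<close>] unfolding div_iff[OF \<alpha>0] by auto
    qed
  next
    assume "(k = 1 \<and> \<beta> \<le> \<alpha>) \<or> (k \<ge> 2 \<and> \<beta> < real k * \<alpha> / (1 + (real k - 1) * \<alpha>)) \<or>
      (k \<ge> 2 \<and> \<beta> = real k * \<alpha> / (1 + (real k - 1) * \<alpha>) \<and> computable_real \<alpha> \<and> computable_real \<beta>)"
    then consider "\<beta> \<le> \<alpha>" | "k \<ge> 2" "\<beta> * (1 + (real k - 1) * \<alpha>) < k * \<alpha>"
      | "\<beta> * (1 + (real k - 1) * \<alpha>) = k * \<alpha>" "computable_real \<beta>"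
      unfolding div_iff[OF \<alpha>0] by blast
    then show "(\<alpha>, \<beta>) \<in> EXTp U k"
    proof cases
      case 1
      then show ?thesis using identity_extractable assms by blast
    next
      case 2
      \<comment> \<open>Solving the equation of the curve for \<alpha> gives
        \<open>\<beta> / c\<close>. A rational \<open>x\<close> between this value and \<alpha> has
        a rational point \<open>y\<close> of the curve above it with
        \<open>\<beta> \<le> y\<close>.\<close>
      define c where "c = k - (real k - 1) * \<beta>"
      have "(real k - 1) * \<beta> \<le> real k - 1" using assms(2,4) by (intro mult_right_le_one_le) auto
      then have "1 \<le> c" by (simp add: c_def)
      have "\<beta> / c < \<alpha>" using 2(2) \<open>1 \<le> c\<close> by (simp add: pos_divide_less_eq c_def algebra_simps)
      then obtain x where x: "x \<in> \<rat>" "\<beta> / c < x" "x < \<alpha>" using Rats_dense_in_real by blast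
      have "0 \<le> \<beta> / c" using assms(4) \<open>1 \<le> c\<close> by simp
      with x have "0 < x" "x \<le> 1" using assms(3) by auto
      define y where "y = k * x / (1 + (real k - 1) * x)"
      have "0 \<le> y" unfolding y_def using pos[of x] \<open>0 < x\<close> by (intro divide_nonneg_pos) auto
      have "y \<le> 1" unfolding y_def using pos[of x] \<open>0 < x\<close> \<open>x \<le> 1\<close> by (simp add: pos_divide_le_eq algebra_simps)
      have "y \<in> \<rat>" unfolding y_def using x(1) by (intro Rats_divide Rats_mult Rats_add Rats_diff) auto
      have eq: "y * (1 + (real k - 1) * x) = k * x" using pos[of x] \<open>0 < x\<close> by (simp add: y_def)
      have "(x, y) \<in> EXTp U k"
        using \<open>0 < x\<close> \<open>x \<le> 1\<close> \<open>0 \<le> y\<close> \<open>y \<le> 1\<close> computable_real_Rats[OF \<open>y \<in> \<rat>\<close>]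
        by (intro boundary_extractable assms(2) eq) auto
      moreover have "\<beta> \<le> y"
      proof -
        have "\<beta> < x * c" using x(2) \<open>1 \<le> c\<close> by (simp add: pos_divide_less_eq)
        then show ?thesis unfolding y_def using pos[of x] \<open>0 < x\<close> by (simp add: pos_le_divide_eq c_def algebra_simps)
      qed
      ultimately show ?thesis using EXTp_mono[of x y U k \<alpha> \<beta>] x(3) assms(3,4) by auto
    next
      case 3
      show ?thesis
      proof (cases "\<alpha> = 0")
        case True
        \<comment> \<open>Here \<beta> is 0, so the level sets of \<open>b\<close> could not be
          bounded; the identity serves instead.\<close>
        then have "\<beta> \<le> \<alpha>" using 3 by simp
        then show ?thesis using identity_extractable assms by blast
      next
        case False
        then show ?thesis using 3 assms by (intro boundary_extractable) auto
      qed
    qed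
  qed
qed

end
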